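(* Let $G$ be a just infinite profinite branch group acting on the rooted tree $T$, such that $G$ is self-reproducing at some vertex $v$. Then there is a constant $c$ such that $\mathrm{ob}_G(n)\le c^n$ for all $n$.
   Context: All subgroups of profinite groups are required to be closed and homomorphisms to be continuous; $n$ ranges over the positive integers. A profinite group is just infinite if it is infinite and every non-trivial normal subgroup has finite index. For a profinite group $G$ and a subgroup $H$, $\mathrm{Ob}_G(H)=H\cap\bigcap\{K\mid K \text{ open normal in } G,\ K\not\le H\}$. Let $I^\lhd_n(G)$ be the intersection of all open normal subgroups of $G$ of index at most $n$, and $\mathrm{ob}_G(n)=|G:\mathrm{Ob}_G(I^\lhd_n(G))|\in\mathbb{N}\cup\{\infty\}$. A rooted tree $T$ is a tree with a distinguished vertex $\emptyset$; every vertex is required to have finite degree, though the tree itself will be infinite in general. The norm $|u|$ of a vertex $u$ is its distance from $\emptyset$; the $n$-th layer is the set of vertices of norm $n$; $T_{[n]}$ is the finite subtree induced by the vertices of norm at most $n$. $\mathrm{Aut}(T)$ is the group of graph automorphisms of $T$ fixing $\emptyset$; it is profinite in the topology generated by declaring open the kernels $\mathrm{St}_{\mathrm{Aut}(T)}(n)$ of the natural maps $\mathrm{Aut}(T)\to\mathrm{Aut}(T_{[n]})$. Let $G$ be a subgroup of $\mathrm{Aut}(T)$. $G$ acts spherically transitively if it acts transitively on each layer. For a vertex $v$, $T_v$ is the rooted tree with root $v$ induced by the vertices descending from $v$ in $T$; $U^G_v$ is the group of automorphisms of $T_v$ induced by the stabiliser of $v$ in $G$; $L^G_v$ is the subgroup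 of $G$ that fixes $v$ and every vertex of $T$ outside $T_v$. If $v_1,\dots,v_k$ are all the vertices of the $n$-th layer, put $U^G_{[n]}=U^G_{v_1}\times\dots\times U^G_{v_k}$, in which $L^G_{v_1}\times\dots\times L^G_{v_k}$ embeds naturally. $G$ is a branch group if it acts spherically transitively and $|U^G_{[n]}:L^G_{v_1}\times\dots\times L^G_{v_k}|$ is finite for all $n$. $G$ is self-reproducing at $v$ if there is an isomorphism from $T$ to $T_v$ that induces an isomorphism from $G$ to $U^G_v$.
   Formalization: The vertex v at which G is self-reproducing is required not to be the root: every G is self-reproducing at the root, and the bound fails for some just infinite branch groups (iterated wreath products of products of two simple groups of very different orders). *)

theory Defs
  imports
    "HOL-Algebra.Bij"
    "HOL-Algebra.Product_Groups"
    "HOL-Analysis.Abstract_Topology"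
    "HOL-Library.Extended_Nat"
begin

section \<open>Groups with a topology\<close>

text \<open>A topological group is given by a group \<open>G\<close> and a topology \<open>X\<close> on \<open>carrier G\<close>.  Following the
  convention for profinite groups, only closed subgroups count as subgroups.\<close>

definition group_index :: "('a, 'b) monoid_scheme \<Rightarrow> 'a set \<Rightarrow> enat" where
  "group_index G H =
     (if finite (rcosets\<^bsub>G\<^esub> H) then enat (card (rcosets\<^bsub>G\<^esub> H)) else \<infinity>)"

definition just_infinite :: "('a, 'b) monoid_scheme \<Rightarrow> 'a topology \<Rightarrow> bool" where
  "just_infinite G X \<longleftrightarrow>
     infinite (carrier G) \<and>
     (\<forall>N. N \<lhd> G \<and> closedin X N \<and> N \<noteq> {\<one>\<^bsub>G\<^esub>} \<longrightarrow> group_index G N < \<infinity>)"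

definition Ob :: "('a, 'b) monoid_scheme \<Rightarrow> 'a topology \<Rightarrow> 'a set \<Rightarrow> 'a set" where
  "Ob G X H = H \<inter> \<Inter>{K. K \<lhd> G \<and> openin X K \<and> \<not> K \<subseteq> H}"

text \<open>For \<open>n = 0\<close> the intersection below is empty, hence \<open>UNIV\<close>; only \<open>n \<ge> 1\<close> is meaningful.\<close>

definition open_normal_inter :: "('a, 'b) monoid_scheme \<Rightarrow> 'a topology \<Rightarrow> nat \<Rightarrow> 'a set" where
  "open_normal_inter G X n = \<Inter>{K. K \<lhd> G \<and> openin X K \<and> group_index G K \<le> enat n}"

definition ob :: "('a, 'b) monoid_scheme \<Rightarrow> 'a topology \<Rightarrow> nat \<Rightarrow> enat" where
  "ob G X n = group_index G (Ob G X (open_normal_inter G X n))"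


section \<open>Rooted trees\<close>

record 'a rgraph =
  verts :: "'a set"
  edges :: "('a \<times> 'a) set"
  rt :: 'a

definition is_path :: "'a rgraph \<Rightarrow> 'a list \<Rightarrow> bool" where
  "is_path T p \<longleftrightarrow>
     p \<noteq> [] \<and> set p \<subseteq> verts T \<and> distinct p \<and> successively (\<lambda>x y. (x, y) \<in> edges T) p"

definition is_cycle :: "'a rgraph \<Rightarrow> 'a list \<Rightarrow> bool" where
  "is_cycle T p \<longleftrightarrow> is_path T p \<and> 3 \<le> length p \<and> (last p, hd p) \<in> edges T"

text \<open>A simple undirected graph is encoded by a symmetric irreflexive edge relation.  The AFP
  entry Graph-Theory is not used, since there a digraph with opposite arcs is never a tree.  Finite
  degree is part of the definition.\<close>

definition rooted_tree :: "'a rgraph \<Rightarrow> bool" where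
  "rooted_tree T \<longleftrightarrow>
     edges T \<subseteq> verts T \<times> verts T \<and> sym (edges T) \<and> irrefl (edges T) \<and>
     rt T \<in> verts T \<and>
     (\<forall>x\<in>verts T. \<forall>y\<in>verts T. \<exists>p. is_path T p \<and> hd p = x \<and> last p = y) \<and>
     (\<nexists>p. is_cycle T p) \<and>
     (\<forall>x\<in>verts T. finite {y. (x, y) \<in> edges T})"

definition vnorm :: "'a rgraph \<Rightarrow> 'a \<Rightarrow> nat" where
  "vnorm T u = (LEAST n. (rt T, u) \<in> edges T ^^ n)"

definition layer :: "'a rgraph \<Rightarrow> nat \<Rightarrow> 'a set" where
  "layer T n = {u \<in> verts T. vnorm T u = n}"

definition descendants :: "'a rgraph \<Rightarrow> 'a \<Rightarrow> 'a set" where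
  "descendants T v = {w. \<exists>p. is_path T p \<and> hd p = rt T \<and> last p = w \<and> v \<in> set p}"

definition subtree :: "'a rgraph \<Rightarrow> 'a \<Rightarrow> 'a rgraph" where
  "subtree T v =
     \<lparr>verts = descendants T v,
      edges = edges T \<inter> (descendants T v \<times> descendants T v),
      rt = v\<rparr>"

definition rooted_iso :: "'a rgraph \<Rightarrow> 'b rgraph \<Rightarrow> ('a \<Rightarrow> 'b) set" where
  "rooted_iso S T =
     {f. bij_betw f (verts S) (verts T) \<and> f (rt S) = rt T \<and>
         (\<forall>x\<in>verts S. \<forall>y\<in>verts S. (f x, f y) \<in> edges T \<longleftrightarrow> (x, y) \<in> edges S)}"


section \<open>The automorphism group of a rooted tree\<close>

text \<open>As in \<^const>\<open>BijGroup\<close>, automorphisms are extensional functions on the vertex set.\<close>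

definition tree_aut :: "'a rgraph \<Rightarrow> ('a \<Rightarrow> 'a) monoid" where
  "tree_aut T = (BijGroup (verts T))\<lparr>carrier := Bij (verts T) \<inter> rooted_iso T T\<rparr>"

definition level_stab :: "'a rgraph \<Rightarrow> nat \<Rightarrow> ('a \<Rightarrow> 'a) set" where
  "level_stab T n = {g \<in> carrier (tree_aut T). \<forall>u\<in>verts T. vnorm T u \<le> n \<longrightarrow> g u = u}"

definition aut_topology :: "'a rgraph \<Rightarrow> ('a \<Rightarrow> 'a) topology" where
  "aut_topology T =
     topology_generated_by {g <#\<^bsub>tree_aut T\<^esub> level_stab T n | g n. g \<in> carrier (tree_aut T)}"

text \<open>In what follows a subgroup of \<open>tree_aut T\<close> is a set of automorphisms; the next two
  constants equip it with its group structure and its profinite topology.\<close>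

definition aut_group :: "'a rgraph \<Rightarrow> ('a \<Rightarrow> 'a) set \<Rightarrow> ('a \<Rightarrow> 'a) monoid" where
  "aut_group T G = (tree_aut T)\<lparr>carrier := G\<rparr>"

definition sub_topology :: "'a rgraph \<Rightarrow> ('a \<Rightarrow> 'a) set \<Rightarrow> ('a \<Rightarrow> 'a) topology" where
  "sub_topology T G = subtopology (aut_topology T) G"

definition closed_subgroup :: "'a rgraph \<Rightarrow> ('a \<Rightarrow> 'a) set \<Rightarrow> bool" where
  "closed_subgroup T G \<longleftrightarrow> subgroup G (tree_aut T) \<and> closedin (aut_topology T) G"

definition spherically_transitive :: "'a rgraph \<Rightarrow> ('a \<Rightarrow> 'a) set \<Rightarrow> bool" where
  "spherically_transitive T G \<longleftrightarrow> (\<forall>n. \<forall>u\<in>layer T n. \<forall>w\<in>layer T n. \<exists>g\<in>G. g u = w)"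

text \<open>\<open>U_set T G v\<close> is a subgroup of \<open>tree_aut (subtree T v)\<close>, and \<open>L_set T G v\<close> is a subgroup
  of \<open>G\<close>.\<close>

definition U_set :: "'a rgraph \<Rightarrow> ('a \<Rightarrow> 'a) set \<Rightarrow> 'a \<Rightarrow> ('a \<Rightarrow> 'a) set" where
  "U_set T G v = {restrict g (descendants T v) | g. g \<in> G \<and> g v = v}"

definition U_group :: "'a rgraph \<Rightarrow> ('a \<Rightarrow> 'a) set \<Rightarrow> 'a \<Rightarrow> ('a \<Rightarrow> 'a) monoid" where
  "U_group T G v = aut_group (subtree T v) (U_set T G v)"

definition L_set :: "'a rgraph \<Rightarrow> ('a \<Rightarrow> 'a) set \<Rightarrow> 'a \<Rightarrow> ('a \<Rightarrow> 'a) set" where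
  "L_set T G v = {g \<in> G. g v = v \<and> (\<forall>w\<in>verts T - descendants T v. g w = w)}"

definition U_layer ::
  "'a rgraph \<Rightarrow> ('a \<Rightarrow> 'a) set \<Rightarrow> nat \<Rightarrow> ('a \<Rightarrow> 'a \<Rightarrow> 'a) monoid" where
  "U_layer T G n = product_group (layer T n) (U_group T G)"

text \<open>The natural embedding of the product of the \<open>L_set T G v\<close> into \<open>U_layer T G n\<close> restricts the
  factor at \<open>v\<close> to the subtree at \<open>v\<close>; this is its image.\<close>

definition L_layer :: "'a rgraph \<Rightarrow> ('a \<Rightarrow> 'a) set \<Rightarrow> nat \<Rightarrow> ('a \<Rightarrow> 'a \<Rightarrow> 'a) set" where
  "L_layer T G n =
     (\<Pi>\<^sub>E v\<in>layer T n. (\<lambda>g. restrict g (descendants T v)) ` L_set T G v)"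

definition branch_group :: "'a rgraph \<Rightarrow> ('a \<Rightarrow> 'a) set \<Rightarrow> bool" where
  "branch_group T G \<longleftrightarrow>
     spherically_transitive T G \<and>
     (\<forall>n. group_index (U_layer T G n) (L_layer T G n) < \<infinity>)"

text \<open>An isomorphism \<open>\<phi>\<close> from \<open>T\<close> to the subtree at \<open>v\<close> acts on automorphisms by conjugation.
  Every \<open>G\<close> is self-reproducing at the root \<open>rt T\<close>, so the notion has content only for the
  other vertices.\<close>

definition self_reproducing_at :: "'a rgraph \<Rightarrow> ('a \<Rightarrow> 'a) set \<Rightarrow> 'a \<Rightarrow> bool" where
  "self_reproducing_at T G v \<longleftrightarrow>
     (\<exists>\<phi>\<in>rooted_iso T (subtree T v).
        (\<lambda>g. restrict (\<phi> \<circ> g \<circ> inv_into (verts T) \<phi>) (descendants T v))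
          \<in> iso (aut_group T G) (U_group T G v))"

end

theory Submission
  imports Defs
begin

text \<open>Let \<open>m\<close> be the norm of \<open>v\<close>, let \<open>d\<close> be the number of vertices of norm \<open>m\<close>, let \<open>f\<close> be the isomorphism
  from \<open>T\<close> to \<open>T\<^sub>v\<close>, put \<open>v\<^sub>r = f\<^sup>r(\<emptyset>)\<close>, and write \<open>St(k)\<close> for the pointwise stabiliser in \<open>G\<close> of the vertices of
  norm at most \<open>k\<close>.  The idea is that the level stabilisers interleave with the open normal subgroups:
  an open normal subgroup that moves a vertex of norm \<open>r m\<close> contains \<open>St(r m + t)\<close>, with \<open>t\<close> independent of
  \<open>r\<close> and of the subgroup.

  The elements of \<open>G\<close> whose copy in \<open>T\<^sub>v\<close> belongs to \<open>G\<close> form a closed subgroup of finite index, by the branch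
  property.  It contains some \<open>St(k)\<close>, and iteration shows that every element of \<open>St(k)\<close> has its copy in
  \<open>T\<^bsub>v\<^sub>r\<^esub>\<close>, extended by the identity, in \<open>G\<close> for all \<open>r\<close> (\<open>exists_regular_level\<close>).  The group \<open>St(k)\<close> is not abelian,
  so the closed normal subgroup generated by its commutators is non-trivial and, as \<open>G\<close> is just infinite,
  contains some \<open>St(t)\<close> (\<open>exists_commutator_level\<close>).  If a normal subgroup \<open>K\<close> contains an element moving
  \<open>v\<^sub>r\<close>, then \<open>K\<close> contains all commutators of elements of \<open>G\<close> supported in \<open>T\<^bsub>v\<^sub>r\<^esub>\<close>
  (\<open>commutator_mem_normal\<close>).  Combining these facts, an open normal \<open>K\<close> that moves a
  vertex of norm \<open>r m\<close>, and hence \<open>v\<^sub>r\<close>, contains the copies of \<open>St(t)\<close> in the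
  subtrees at all vertices of norm \<open>r m\<close>, hence \<open>St(r m + t)\<close> (\<open>normal_contains_St\<close>).

  Now let \<open>K\<close> be open normal of index at most \<open>n\<close>, and let \<open>r\<close> be minimal such that \<open>K\<close> moves a vertex of norm
  \<open>r m\<close>.  Then \<open>K\<close> fixes the \<open>d\<^bsup>r - 1\<^esup>\<close> vertices of norm \<open>(r - 1) m\<close>, on which \<open>G\<close> is transitive, so
  \<open>d\<^bsup>r - 1\<^esup> \<le> n\<close>.  With \<open>d\<^sup>p \<le> n < d\<^bsup>p + 1\<^esup>\<close>, the intersection of all such \<open>K\<close> contains \<open>St((p + 1) m + t)\<close>, and
  every open normal subgroup not contained in this intersection contains \<open>St((p + 1 + 2 t) m)\<close>.
  Finally, self-reproduction gives \<open>|G : St(r m)| \<le> q\<close> to the power \<open>d\<^sup>r\<close>, where \<open>q = |G : St(m)|\<close> (\<open>card_germs_le\<close>); for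
  \<open>r = p + 1 + 2 t\<close> the exponent is at most \<open>d\<^bsup>1 + 2 t\<^esup> n\<close>.\<close>

section \<open>Groups acting on the levels of a tree\<close>

lemma restrict_eqD: "\<lbrakk>restrict g A = restrict h A; x \<in> A\<rbrakk> \<Longrightarrow> g x = h x"
  by (metis restrict_apply')

text \<open>A group acting on the vertices of an abstract rooted tree: \<open>lev u\<close> is the norm of \<open>u\<close>, \<open>D u\<close> the set
  of its descendants (including \<open>u\<close>), and the action is faithful and transitive on each level.  The
  tree enters only through these two functions, so edges play no role here.\<close>
locale level_action = group G for G :: "('a \<Rightarrow> 'a) monoid" (structure) +
  fixes V :: "'a set" and lev :: "'a \<Rightarrow> nat" and D :: "'a \<Rightarrow> 'a set" and root :: 'a
  assumes act_ext: "\<lbrakk>g \<in> carrier G; h \<in> carrier G; \<And>u. u \<in> V \<Longrightarrow> g u = h u\<rbrakk> \<Longrightarrow> g = h"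
    and act_mult: "\<lbrakk>g \<in> carrier G; h \<in> carrier G; u \<in> V\<rbrakk> \<Longrightarrow> (g \<otimes> h) u = g (h u)"
    and act_one: "u \<in> V \<Longrightarrow> \<one> u = u"
    and act_closed: "\<lbrakk>g \<in> carrier G; u \<in> V\<rbrakk> \<Longrightarrow> g u \<in> V"
    and lev_act: "\<lbrakk>g \<in> carrier G; u \<in> V\<rbrakk> \<Longrightarrow> lev (g u) = lev u"
    and D_act: "\<lbrakk>g \<in> carrier G; u \<in> V; w \<in> D u\<rbrakk> \<Longrightarrow> g w \<in> D (g u)"
    and act_trans: "\<lbrakk>u \<in> V; w \<in> V; lev u = lev w\<rbrakk> \<Longrightarrow> \<exists>g\<in>carrier G. g u = w"
    and D_sub: "u \<in> V \<Longrightarrow> D u \<subseteq> V"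
    and D_self: "u \<in> V \<Longrightarrow> u \<in> D u"
    and D_trans: "\<lbrakk>x \<in> V; u \<in> D x; w \<in> D u\<rbrakk> \<Longrightarrow> w \<in> D x"
    and D_lev: "\<lbrakk>u \<in> V; w \<in> D u\<rbrakk> \<Longrightarrow> lev u \<le> lev w"
    and D_unique: "\<lbrakk>u \<in> V; u' \<in> V; w \<in> D u; w \<in> D u'; lev u = lev u'\<rbrakk> \<Longrightarrow> u = u'"
    and D_exists: "\<lbrakk>w \<in> V; k \<le> lev w\<rbrakk> \<Longrightarrow> \<exists>u\<in>V. lev u = k \<and> w \<in> D u"
    and root_V: "root \<in> V" and D_root: "D root = V" and lev_root: "lev root = 0"
    and finite_layer: "finite {u \<in> V. lev u = k}"
begin

lemma inv_act [simp]: "\<lbrakk>g \<in> carrier G; u \<in> V\<rbrakk> \<Longrightarrow> (inv g) (g u) = u"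
  by (metis act_mult act_one inv_closed l_inv)

lemma act_inv [simp]: "\<lbrakk>g \<in> carrier G; u \<in> V\<rbrakk> \<Longrightarrow> g ((inv g) u) = u"
  by (metis act_mult act_one inv_closed r_inv)

declare act_closed [simp] act_mult [simp] act_one [simp] lev_act [simp] D_self [simp]
  root_V [simp] lev_root [simp]

lemma D_in_V [intro]: "\<lbrakk>w \<in> D u; u \<in> V\<rbrakk> \<Longrightarrow> w \<in> V"
  using D_sub by blast

lemma D_act_iff: "\<lbrakk>g \<in> carrier G; u \<in> V; w \<in> V\<rbrakk> \<Longrightarrow> g w \<in> D (g u) \<longleftrightarrow> w \<in> D u"
  by (metis D_act act_closed inv_act inv_closed)

lemma act_eq_iff: "\<lbrakk>g \<in> carrier G; u \<in> V; w \<in> V\<rbrakk> \<Longrightarrow> g u = g w \<longleftrightarrow> u = w"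
  by (metis inv_act)

lemma fixes_ancestor:
  "\<lbrakk>g \<in> carrier G; u \<in> V; w \<in> D u; g w = w\<rbrakk> \<Longrightarrow> g u = u"
  by (metis D_act D_unique act_closed lev_act)

lemma moves_vertex:
  assumes "x \<in> carrier G" "x \<noteq> \<one>"
  shows "\<exists>u\<in>V. x u \<noteq> u"
proof (rule ccontr)
  assume "\<not> ?thesis"
  then have "x = \<one>" by (intro act_ext assms(1) one_closed) simp
  then show False using assms(2) by simp
qed

lemma eq_root_if_lev_0: "\<lbrakk>u \<in> V; lev u = 0\<rbrakk> \<Longrightarrow> u = root"
  using D_unique[of u root u] by (auto simp: D_root)

text \<open>The pointwise stabiliser in \<open>G\<close> of all vertices of level at most \<open>k\<close>.\<close>
definition St :: "nat \<Rightarrow> ('a \<Rightarrow> 'a) set" where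
  "St k = {g \<in> carrier G. \<forall>u\<in>V. lev u \<le> k \<longrightarrow> g u = u}"

lemma St_carrier: "g \<in> St k \<Longrightarrow> g \<in> carrier G" by (simp add: St_def)

lemma St_fix: "\<lbrakk>g \<in> St k; u \<in> V; lev u \<le> k\<rbrakk> \<Longrightarrow> g u = u" by (simp add: St_def)

lemma St_antimono: "k \<le> l \<Longrightarrow> St l \<subseteq> St k"
  by (auto simp: St_def)

lemma St_normal: "St k \<lhd> G"
proof -
  have "subgroup (St k) G"
  proof (rule subgroupI)
    show "St k \<noteq> {}"
      using one_closed by (auto simp: St_def)
    show "inv a \<in> St k" if "a \<in> St k" for a
      using that unfolding St_def by (auto intro: inv_closed) (metis inv_act)
  qed (auto simp: St_def)
  then show ?thesis
    unfolding normal_inv_iff by (auto simp: St_def)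
qed

lemma agree_St:
  assumes "g \<in> carrier G" "h \<in> carrier G" "\<And>u. \<lbrakk>u \<in> V; lev u \<le> k\<rbrakk> \<Longrightarrow> g u = h u"
  shows "g \<otimes> inv h \<in> St k"
  using assms unfolding St_def by simp

lemma agree_mem:
  assumes "subgroup K G" "St k \<subseteq> K" "g \<in> carrier G" "h \<in> K"
    "\<And>u. \<lbrakk>u \<in> V; lev u \<le> k\<rbrakk> \<Longrightarrow> g u = h u"
  shows "g \<in> K"
proof -
  have h: "h \<in> carrier G" using subgroup.mem_carrier[OF assms(1,4)] .
  have "g \<otimes> inv h \<in> K" using agree_St[OF assms(3) h assms(5)] assms(2) by blast
  then have "g \<otimes> inv h \<otimes> h \<in> K" using subgroup.m_closed[OF assms(1)] assms(4) by simp
  then show ?thesis using assms h by (simp add: m_assoc)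
qed

text \<open>Closedness in the topology with the \<open>St k\<close> as a neighbourhood basis of the identity: an element of
  \<open>G\<close> that agrees with elements of \<open>C\<close> up to any given level belongs to \<open>C\<close>.\<close>
definition lev_closed :: "('a \<Rightarrow> 'a) set \<Rightarrow> bool" where
  "lev_closed C \<longleftrightarrow> C \<subseteq> carrier G \<and>
     (\<forall>g\<in>carrier G. (\<forall>k. \<exists>c\<in>C. \<forall>u\<in>V. lev u \<le> k \<longrightarrow> c u = g u) \<longrightarrow> g \<in> C)"

text \<open>A closed subgroup of finite index is open.  The finite set \<open>F\<close> contains a representative of each
  right coset of \<open>C\<close>.\<close>
lemma lev_closed_finite_cover_St:
  assumes C: "lev_closed C" and sub: "subgroup C G" and F: "finite F" "F \<subseteq> carrier G"
    and cover: "\<And>x. x \<in> carrier G \<Longrightarrow> \<exists>y\<in>F. x \<otimes> inv y \<in> C"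
  shows "\<exists>k. St k \<subseteq> C"
proof -
  have "\<exists>k. \<forall>c\<in>C. \<exists>u\<in>V. lev u \<le> k \<and> c u \<noteq> y u" if "y \<in> F - C" for y
  proof (rule ccontr)
    assume "\<not> ?thesis"
    then have "\<forall>k. \<exists>c\<in>C. \<forall>u\<in>V. lev u \<le> k \<longrightarrow> c u = y u" by simp
    with C F(2) that show False unfolding lev_closed_def by auto
  qed
  then obtain K where K: "\<And>y. y \<in> F - C \<Longrightarrow> \<forall>c\<in>C. \<exists>u\<in>V. lev u \<le> K y \<and> c u \<noteq> y u"
    by metis
  \<comment> \<open>\<open>K y\<close> is a level up to which no element of \<open>C\<close> agrees with the representative \<open>y\<close>.\<close>
  define k where "k = Max (insert 0 (K ` F))"
  have k: "K y \<le> k" if "y \<in> F" for y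
    unfolding k_def using F that by auto
  have "x \<in> C" if x: "x \<in> St k" for x
  proof (rule ccontr)
    assume nx: "x \<notin> C"
    have xc: "x \<in> carrier G" using x St_carrier by blast
    obtain y where y: "y \<in> F" "x \<otimes> inv y \<in> C" using cover[OF xc] by blast
    have yc: "y \<in> carrier G" using y F by blast
    have "y \<notin> C"
    proof
      assume "y \<in> C"
      then have "x \<otimes> inv y \<otimes> y \<in> C" using subgroup.m_closed[OF sub] y(2) by simp
      then show False using xc yc nx by (simp add: m_assoc)
    qed
    moreover have "inv (x \<otimes> inv y) \<in> C" using subgroup.m_inv_closed[OF sub] y(2) by simp
    ultimately obtain u where u: "u \<in> V" "lev u \<le> K y" "(inv (x \<otimes> inv y)) u \<noteq> y u"
      using K[of y] y(1) by blast
    have "(inv (x \<otimes> inv y)) u = y ((inv x) u)"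
      using xc yc u by (simp add: inv_mult_group)
    moreover have "(inv x) u = u"
      using St_fix[OF x u(1)] u k[OF y(1)] inv_act[OF xc u(1)] by simp
    ultimately show False using u by simp
  qed
  then show ?thesis by blast
qed

lemma finite_rcosets_cover:
  assumes "finite (rcosets H)" "subgroup H G"
  obtains F where "finite F" "F \<subseteq> carrier G"
    "\<And>x. x \<in> carrier G \<Longrightarrow> \<exists>y\<in>F. x \<otimes> inv y \<in> H"
proof -
  have "rcosets H \<subseteq> (\<lambda>a. H #> a) ` carrier G" by (auto simp: RCOSETS_def)
  from finite_subset_image[OF assms(1) this]
  obtain F where F: "F \<subseteq> carrier G" "finite F" "rcosets H = (\<lambda>a. H #> a) ` F"
    by metis
  have "\<exists>y\<in>F. x \<otimes> inv y \<in> H" if x: "x \<in> carrier G" for x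
  proof -
    have "H #> x \<in> rcosets H" using x by (auto simp: RCOSETS_def)
    then obtain y where y: "y \<in> F" "H #> x = H #> y" unfolding F(3) by blast
    then have "x \<in> H #> y" using rcos_self[OF x assms(2)] by simp
    then show ?thesis
      using subgroup.rcos_module_imp[OF assms(2) is_group _ _] y F x by blast
  qed
  then show thesis using that[OF F(2,1)] by blast
qed

text \<open>The set of vertices of level \<open>k\<close>.\<close>
definition level :: "nat \<Rightarrow> 'a set" where "level k = {u \<in> V. lev u = k}"

text \<open>If \<open>K\<close> fixes the vertex \<open>w\<close>, then a coset \<open>K g\<close> determines the vertex \<open>g\<inverse> w\<close>, and every vertex
  of the level of \<open>w\<close> arises in this way.\<close>
lemma card_level_le_index:
  assumes K: "subgroup K G" and sub: "K \<subseteq> St k" and fin: "finite (rcosets K)"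
    and ne: "w \<in> level k"
  shows "card (level k) \<le> card (rcosets K)"
proof -
  have w: "w \<in> V" "lev w = k" using ne by (auto simp: level_def)
  define \<theta> where "\<theta> = (\<lambda>C. (inv (SOME x. x \<in> C)) w)"
  have "level k \<subseteq> \<theta> ` (rcosets K)"
  proof
    fix u assume "u \<in> level k"
    then have u: "u \<in> V" "lev u = k" by (auto simp: level_def)
    obtain g where g: "g \<in> carrier G" "g u = w" using act_trans u w by metis
    have "g \<in> K #> g" using rcos_self[OF g(1) K] .
    then have "(SOME x. x \<in> K #> g) \<in> K #> g" by (metis someI)
    then obtain a where a: "a \<in> K" "(SOME x. x \<in> K #> g) = a \<otimes> g" by (auto simp: r_coset_def)
    have ac: "a \<in> St k" using a sub by blast
    have "(inv a) w = w" using St_fix[OF ac w(1)] w St_carrier[OF ac] inv_act by fastforce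
    then have "\<theta> (K #> g) = u"
      unfolding \<theta>_def a(2) using g u w St_carrier[OF ac] inv_act[of g u] by (simp add: inv_mult_group)
    moreover have "K #> g \<in> rcosets K" using g by (auto simp: RCOSETS_def)
    ultimately show "u \<in> \<theta> ` (rcosets K)" by blast
  qed
  then show ?thesis by (rule surj_card_le[OF fin])
qed

text \<open>The set of vertices of level at most \<open>k\<close>.\<close>
definition ball :: "nat \<Rightarrow> 'a set" where "ball k = {u \<in> V. lev u \<le> k}"

text \<open>The restrictions to \<open>ball k\<close> of the elements of \<open>G\<close>, which stand for the elements of the finite
  quotient \<open>G / St k\<close>.\<close>
definition germs :: "nat \<Rightarrow> ('a \<Rightarrow> 'a) set" where "germs k = (\<lambda>g. restrict g (ball k)) ` carrier G"

lemma finite_ball: "finite (ball k)"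
proof -
  have "ball k = (\<Union>j\<le>k. {u \<in> V. lev u = j})" by (auto simp: ball_def)
  then show ?thesis using finite_layer by auto
qed

lemma finite_germs: "finite (germs k)"
proof -
  have "germs k \<subseteq> (\<Pi>\<^sub>E u\<in>ball k. ball k)"
    unfolding germs_def
    by (intro image_subsetI) (simp add: restrict_PiE_iff, simp add: ball_def)
  then show ?thesis using finite_ball finite_PiE finite_subset by metis
qed

lemma card_germs_pos: "1 \<le> card (germs k)"
proof -
  have "germs k \<noteq> {}" using one_closed by (auto simp: germs_def)
  then show ?thesis using finite_germs card_gt_0_iff by (metis One_nat_def Suc_leI)
qed

lemma index_le_germs:
  assumes K: "subgroup K G" and sub: "St k \<subseteq> K"
  shows "finite (rcosets K)" "card (rcosets K) \<le> card (germs k)"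
proof -
  define \<theta> where "\<theta> = (\<lambda>e. K #> (SOME g. g \<in> carrier G \<and> restrict g (ball k) = e))"
  have "rcosets K \<subseteq> \<theta> ` germs k"
  proof
    fix C assume "C \<in> rcosets K"
    then obtain g where g: "g \<in> carrier G" "C = K #> g" by (auto simp: RCOSETS_def)
    define h where "h = (SOME h. h \<in> carrier G \<and> restrict h (ball k) = restrict g (ball k))"
    have h: "h \<in> carrier G \<and> restrict h (ball k) = restrict g (ball k)"
      unfolding h_def by (rule someI[of _ g]) (use g in auto)
    have ag: "h u = g u" if "u \<in> V" "lev u \<le> k" for u
      using h that by (auto simp: ball_def dest: restrict_eqD)
    have "h \<otimes> inv g \<in> K" using agree_St[of h g k] h g ag sub by blast
    then have "h \<in> K #> g"
      using subgroup.rcos_module_rev[OF K is_group g(1)] h by simp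
    then have "K #> g = K #> h" using repr_independence K g by simp
    then have "C = \<theta> (restrict g (ball k))"
      by (simp add: \<theta>_def g(2) h_def)
    moreover have "restrict g (ball k) \<in> germs k" using g(1) by (simp add: germs_def)
    ultimately show "C \<in> \<theta> ` germs k" by (rule image_eqI)
  qed
  from finite_surj[OF finite_germs this] surj_card_le[OF finite_germs this]
  show "finite (rcosets K)" "card (rcosets K) \<le> card (germs k)" .
qed

lemma St_nontrivial:
  assumes "infinite (carrier G)"
  shows "\<exists>g\<in>St k. g \<noteq> \<one>"
proof (rule ccontr)
  assume "\<not> ?thesis"
  then have S: "St k \<subseteq> {\<one>}" by blast
  have "inj_on (\<lambda>g. restrict g (ball k)) (carrier G)"
  proof (rule inj_onI)
    fix g h assume gh: "g \<in> carrier G" "h \<in> carrier G" "restrict g (ball k) = restrict h (ball k)"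
    have ag: "g u = h u" if "u \<in> V" "lev u \<le> k" for u
      using gh(3) that by (auto simp: ball_def dest: restrict_eqD)
    have "g \<otimes> inv h = \<one>" using agree_St[OF gh(1,2) ag] S by blast
    then show "g = h" using gh(1,2) by (simp add: inv_solve_right')
  qed
  then show False using finite_germs[of k] assms finite_imageD unfolding germs_def by auto
qed

text \<open>If the automorphism \<open>g\<close> fixes a level pointwise, then it is the product of its restrictions to the
  subtrees at that level, each extended by the identity.  The factors commute, and the product can be
  formed one subtree at a time; if all factors lie in \<open>K\<close>, so does \<open>g\<close>.\<close>
lemma glue_mem:
  assumes K: "subgroup K G" and S: "finite S" "S \<subseteq> level k" and g: "g \<in> St k"
    and pieces: "\<And>w. w \<in> S \<Longrightarrow> \<exists>e\<in>K. (\<forall>u\<in>D w. e u = g u) \<and> (\<forall>u\<in>V - D w. e u = u)"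
  shows "\<exists>e\<in>K. (\<forall>w\<in>S. \<forall>u\<in>D w. e u = g u) \<and> (\<forall>u\<in>V - (\<Union>w\<in>S. D w). e u = u)"
  using S pieces
proof (induction S)
  case empty
  have "\<one> \<in> K" using K subgroup.one_closed by blast
  then show ?case by (intro bexI[of _ \<one>]) auto
next
  case (insert w S)
  have "\<exists>e\<in>K. (\<forall>w\<in>S. \<forall>u\<in>D w. e u = g u) \<and> (\<forall>u\<in>V - (\<Union>w\<in>S. D w). e u = u)"
    using insert.prems by (intro insert.IH) simp_all
  then obtain e where e: "e \<in> K" "\<forall>w\<in>S. \<forall>u\<in>D w. e u = g u" "\<forall>u\<in>V - (\<Union>w\<in>S. D w). e u = u"
    by blast
  obtain a where a: "a \<in> K" "\<forall>u\<in>D w. a u = g u" "\<forall>u\<in>V - D w. a u = u"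
    using insert.prems(2)[of w] by blast
  have gc: "g \<in> carrier G" using g St_carrier by blast
  have wV: "w \<in> V" "lev w = k" using insert.prems by (auto simp: level_def)
  have SV: "x \<in> V" "lev x = k" if "x \<in> S" for x using insert.prems that by (auto simp: level_def)
  have disj: "D x \<inter> D w = {}" if "x \<in> S" for x
    using D_unique[of x w] SV[OF that] wV that insert.hyps by auto
  have gD: "g u \<in> D x" if "x \<in> V" "lev x = k" "u \<in> D x" for x u
    using D_act[OF gc that(1,3)] St_fix[OF g that(1)] that by simp
  have ec: "e \<in> carrier G" "a \<in> carrier G"
    using subgroup.mem_carrier[OF K] e(1) a(1) by simp_all
  have val: "(e \<otimes> a) u = e (a u)" if "u \<in> V" for u using ec that by simp
  have 1: "(e \<otimes> a) u = g u" if u: "u \<in> D w" for u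
  proof -
    have "g u \<in> D w" using gD wV u by blast
    then have "g u \<in> V - (\<Union>w\<in>S. D w)" using disj wV by blast
    moreover have "u \<in> V" using u wV by blast
    ultimately show ?thesis using val a(2) u e(3) by simp
  qed
  have 2: "(e \<otimes> a) u = g u" if u: "x \<in> S" "u \<in> D x" for x u
  proof -
    have "u \<in> V - D w" using disj[OF u(1)] u SV[OF u(1)] by blast
    then show ?thesis using val a(3) e(2) u by simp
  qed
  have 3: "(e \<otimes> a) u = u" if u: "u \<in> V" "u \<notin> D w" "u \<notin> (\<Union>w\<in>S. D w)" for u
    using val a(3) e(3) u by simp
  have "e \<otimes> a \<in> K" using subgroup.m_closed[OF K] e(1) a(1) by simp
  then show ?case
  proof (rule bexI[rotated], intro conjI ballI)
    show "(e \<otimes> a) u = g u" if "x \<in> insert w S" "u \<in> D x" for x u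
      using that 1 2 by blast
    show "(e \<otimes> a) u = u" if "u \<in> V - (\<Union>x\<in>insert w S. D x)" for u
      using that by (intro 3) blast+
  qed
qed

lemma glue_St:
  assumes K: "subgroup K G" and g: "g \<in> St k"
    and pieces: "\<And>w. w \<in> level k \<Longrightarrow> \<exists>e\<in>K. (\<forall>u\<in>D w. e u = g u) \<and> (\<forall>u\<in>V - D w. e u = u)"
  shows "g \<in> K"
proof -
  obtain e where e: "e \<in> K" "\<forall>w\<in>level k. \<forall>u\<in>D w. e u = g u"
      "\<forall>u\<in>V - (\<Union>w\<in>level k. D w). e u = u"
    using glue_mem[OF K _ subset_refl g pieces] finite_layer by (auto simp: level_def)
  have "e = g"
  proof (rule act_ext)
    show "e u = g u" if u: "u \<in> V" for u
    proof (cases "u \<in> (\<Union>w\<in>level k. D w)")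
      case True
      then show ?thesis using e by blast
    next
      case False
      then have "\<not> k \<le> lev u" using D_exists[OF u, of k] by (auto simp: level_def)
      then show ?thesis using False e u St_fix[OF g u] by simp
    qed
  qed (use e(1) g St_carrier subgroup.mem_carrier[OF K] in blast)+
  then show ?thesis using e by simp
qed

end

section \<open>Copies of group elements in subtrees\<close>

text \<open>The group \<open>G\<close> is moreover infinite, just infinite and closed, and \<open>f\<close> is an isomorphism from the
  tree to the subtree at \<open>f root\<close> which carries \<open>G\<close> to the group induced on that subtree by the
  stabiliser of \<open>f root\<close> (\<open>f_extend\<close>, \<open>f_restrict\<close>).  Closedness in the full automorphism group takes
  the form \<open>complete\<close>: a function that can be approximated by elements of \<open>G\<close> up to any level is in
  \<open>G\<close>.  Of the branch property, only the level of \<open>f root\<close> is needed: by \<open>branch\<close>, those \<open>x \<in> G\<close> whose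
  copy in the subtree at \<open>f root\<close>, extended by the identity, belongs to \<open>G\<close> have finite index.\<close>
locale self_reproducing_action = level_action +
  fixes f :: "'a \<Rightarrow> 'a"
  assumes f_bij: "bij_betw f V (D (f root))"
    and f_root_V: "f root \<in> V" and f_root: "f root \<noteq> root"
    and f_lev: "u \<in> V \<Longrightarrow> lev (f u) = lev (f root) + lev u"
    and f_D: "\<lbrakk>u \<in> V; w \<in> D u\<rbrakk> \<Longrightarrow> f w \<in> D (f u)"
    and f_extend: "x \<in> carrier G \<Longrightarrow> \<exists>g\<in>carrier G. \<forall>u\<in>V. g (f u) = f (x u)"
    and f_restrict: "\<lbrakk>g \<in> carrier G; g (f root) = f root\<rbrakk> \<Longrightarrow>
       \<exists>x\<in>carrier G. \<forall>u\<in>V. g (f u) = f (x u)"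
    and complete: "\<lbrakk>h \<in> extensional V;
         \<And>k. \<exists>g\<in>carrier G. \<forall>u\<in>V. lev u \<le> k \<longrightarrow> h u = g u\<rbrakk> \<Longrightarrow> h \<in> carrier G"
    and branch: "\<exists>F. finite F \<and> F \<subseteq> carrier G \<and> (\<forall>x\<in>carrier G. \<exists>y\<in>F. \<exists>g\<in>carrier G.
         (\<forall>u\<in>V. g (f u) = f ((x \<otimes> inv y) u)) \<and> (\<forall>w\<in>V - D (f root). g w = w))"
    and infinite_G: "infinite (carrier G)"
    and just_inf: "\<lbrakk>N \<lhd> G; lev_closed N; N \<noteq> {\<one>}\<rbrakk> \<Longrightarrow> finite (rcosets N)"
begin

definition m :: nat where "m = lev (f root)"

lemma m_pos: "0 < m"
  using eq_root_if_lev_0[OF f_root_V] f_root by (auto simp: m_def)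

lemma lev_f: "u \<in> V \<Longrightarrow> lev (f u) = m + lev u"
  unfolding m_def by (rule f_lev)

lemma f_V [simp]: "u \<in> V \<Longrightarrow> f u \<in> V"
  using bij_betwE[OF f_bij] D_sub[OF f_root_V] by blast

lemma f_inj: "inj_on f V"
  using f_bij by (simp add: bij_betw_def)

lemma f_D_iff:
  assumes "u \<in> V" "w \<in> V"
  shows "f w \<in> D (f u) \<longleftrightarrow> w \<in> D u"
proof
  assume a: "f w \<in> D (f u)"
  have "lev u \<le> lev w"
    using D_lev[OF f_V[OF assms(1)] a] assms by (simp add: lev_f)
  then obtain u' where u': "u' \<in> V" "lev u' = lev u" "w \<in> D u'"
    using D_exists[OF assms(2)] by blast
  have "f u = f u'"
    using D_unique[OF f_V[OF assms(1)] f_V[OF u'(1)] a f_D[OF u'(1,3)]] u' assms by (simp add: lev_f)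
  then have "u = u'" using inj_onD[OF f_inj _ assms(1) u'(1)] by simp
  then show "w \<in> D u" using u'(3) by simp
next
  show "w \<in> D u \<Longrightarrow> f w \<in> D (f u)" using f_D[OF assms(1)] .
qed

lemma f_image_D:
  assumes u: "u \<in> V"
  shows "f ` D u = D (f u)"
proof
  show "f ` D u \<subseteq> D (f u)" using f_D[OF u] by blast
  show "D (f u) \<subseteq> f ` D u"
  proof
    fix w assume w: "w \<in> D (f u)"
    have "f u \<in> D (f root)" using f_D[OF root_V] u by (simp add: D_root)
    then have "w \<in> D (f root)" using D_trans[OF f_root_V _ w] by blast
    then obtain w' where w': "w' \<in> V" "w = f w'"
      using f_bij by (auto simp: bij_betw_def)
    then have "w' \<in> D u" using f_D_iff[OF u w'(1)] w by simp
    then show "w \<in> f ` D u" using w' by blast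
  qed
qed

text \<open>The iterates of \<open>f\<close> map the tree onto the subtrees at the vertices \<open>vx i\<close>, of level \<open>i * m\<close>.\<close>
abbreviation fp :: "nat \<Rightarrow> 'a \<Rightarrow> 'a" where "fp i \<equiv> f ^^ i"
abbreviation vx :: "nat \<Rightarrow> 'a" where "vx i \<equiv> fp i root"

lemma fp_V [simp]: "u \<in> V \<Longrightarrow> fp i u \<in> V"
  by (induction i) auto

lemma lev_fp: "u \<in> V \<Longrightarrow> lev (fp i u) = i * m + lev u"
  by (induction i) (auto simp: lev_f)

lemma lev_vx [simp]: "lev (vx i) = i * m"
  by (simp add: lev_fp)

lemma fp_inj: "inj_on (fp i) V"
proof (induction i)
  case (Suc i)
  have "inj_on f (fp i ` V)" by (rule inj_on_subset[OF f_inj]) auto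
  then show ?case using comp_inj_on[OF Suc] by (simp add: comp_def)
qed simp

lemma fp_image_V: "fp i ` V = D (vx i)"
proof (induction i)
  case 0
  then show ?case by (simp add: D_root)
next
  case (Suc i)
  have "fp (Suc i) ` V = f ` (fp i ` V)" by (simp add: image_comp)
  also have "\<dots> = D (vx (Suc i))" using Suc f_image_D[OF fp_V[OF root_V]] by simp
  finally show ?case .
qed

lemma fp_extend: "x \<in> carrier G \<Longrightarrow> \<exists>g\<in>carrier G. \<forall>u\<in>V. g (fp i u) = fp i (x u)"
proof (induction i)
  case (Suc i)
  then obtain g where g: "g \<in> carrier G" "\<And>u. u \<in> V \<Longrightarrow> g (fp i u) = fp i (x u)" by blast
  obtain g' where g': "g' \<in> carrier G" "\<And>u. u \<in> V \<Longrightarrow> g' (f u) = f (g u)"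
    using f_extend[OF g(1)] by blast
  have "g' (fp (Suc i) u) = fp (Suc i) (x u)" if "u \<in> V" for u
    using that g g' by simp
  then show ?case using g' by blast
qed auto

lemma act_root [simp]: "g \<in> carrier G \<Longrightarrow> g root = root"
  by (rule eq_root_if_lev_0) simp_all

lemma St_0: "St 0 = carrier G"
proof -
  have "g u = u" if "g \<in> carrier G" "u \<in> V" "lev u = 0" for g u
    using eq_root_if_lev_0[OF that(2,3)] that(1) by simp
  then show ?thesis by (auto simp: St_def)
qed

lemma vx_Suc_D: "vx (Suc i) \<in> D (f root)"
  using f_D[OF root_V, of "vx i"] by (simp add: D_root)

lemma fp_restrict:
  "\<lbrakk>g \<in> carrier G; g (vx i) = vx i\<rbrakk> \<Longrightarrow> \<exists>x\<in>carrier G. \<forall>u\<in>V. g (fp i u) = fp i (x u)"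
proof (induction i arbitrary: g)
  case (Suc i)
  have "g (f root) = f root"
    using fixes_ancestor[OF Suc.prems(1) f_root_V vx_Suc_D Suc.prems(2)] .
  then obtain x where x: "x \<in> carrier G" "\<And>u. u \<in> V \<Longrightarrow> g (f u) = f (x u)"
    using f_restrict[OF Suc.prems(1)] by blast
  have "f (x (vx i)) = f (vx i)"
    using Suc.prems(2) x(2)[of "vx i"] by simp
  then have "x (vx i) = vx i"
    using inj_onD[OF f_inj] x(1) by simp
  then obtain y where y: "y \<in> carrier G" "\<And>u. u \<in> V \<Longrightarrow> x (fp i u) = fp i (y u)"
    using Suc.IH[OF x(1)] by blast
  have "g (fp (Suc i) u) = fp (Suc i) (y u)" if "u \<in> V" for u
    using that x y by simp
  then show ?case using y by blast
qed auto

text \<open>\<open>lift i x g\<close> says that \<open>g \<in> G\<close> acts on the subtree at \<open>vx i\<close> as \<open>x \<in> G\<close> acts on the whole tree,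
  and trivially outside that subtree.  Such a \<open>g\<close> is determined by \<open>x\<close>, but need not exist.\<close>
definition lift :: "nat \<Rightarrow> ('a \<Rightarrow> 'a) \<Rightarrow> ('a \<Rightarrow> 'a) \<Rightarrow> bool" where
  "lift i x g \<longleftrightarrow> x \<in> carrier G \<and> g \<in> carrier G \<and>
     (\<forall>u\<in>V. g (fp i u) = fp i (x u)) \<and> (\<forall>w\<in>V - D (vx i). g w = w)"

lemma liftD:
  assumes "lift i x g"
  shows "x \<in> carrier G" "g \<in> carrier G" "\<And>u. u \<in> V \<Longrightarrow> g (fp i u) = fp i (x u)"
    "\<And>w. \<lbrakk>w \<in> V; w \<notin> D (vx i)\<rbrakk> \<Longrightarrow> g w = w"
  using assms by (auto simp: lift_def)

lemma liftI:
  assumes "x \<in> carrier G" "g \<in> carrier G" "\<And>u. u \<in> V \<Longrightarrow> g (fp i u) = fp i (x u)"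
    "\<And>w. \<lbrakk>w \<in> V; w \<notin> D (vx i)\<rbrakk> \<Longrightarrow> g w = w"
  shows "lift i x g"
  using assms by (auto simp: lift_def)

lemma vx_cases:
  assumes "w \<in> V"
  obtains (inside) u where "u \<in> V" "w = fp i u" "w \<in> D (vx i)" | (outside) "w \<notin> D (vx i)"
  unfolding fp_image_V[of i, symmetric] by blast

lemma lift_agree:
  assumes x: "lift i x g" and y: "lift i y h"
    and ag: "\<And>u. \<lbrakk>u \<in> V; lev u \<le> k\<rbrakk> \<Longrightarrow> x u = y u" and w: "w \<in> V" "lev w \<le> k"
  shows "g w = h w"
  using w(1)
proof (cases rule: vx_cases[of w i])
  case (inside u)
  then have "lev u \<le> k" using w by (simp add: lev_fp)
  then show ?thesis using inside ag[of u] liftD(3)[OF x] liftD(3)[OF y] by simp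
next
  case outside
  then show ?thesis using w liftD(4)[OF x] liftD(4)[OF y] by simp
qed

lemma lift_one: "lift i \<one> \<one>"
  by (rule liftI) simp_all

lemma lift_mult:
  assumes x: "lift i x g" and y: "lift i y h"
  shows "lift i (x \<otimes> y) (g \<otimes> h)"
  using liftD[OF x] liftD[OF y] by (intro liftI) simp_all

lemma intertwine_inv:
  assumes "x \<in> carrier G" "g \<in> carrier G" "\<And>u. u \<in> V \<Longrightarrow> g (fp i u) = fp i (x u)" "u \<in> V"
  shows "(inv g) (fp i u) = fp i ((inv x) u)"
proof -
  have "g (fp i ((inv x) u)) = fp i u" using assms by simp
  then show ?thesis using inv_act[OF assms(2), of "fp i ((inv x) u)"] assms by simp
qed

lemma inv_fix: "\<lbrakk>g \<in> carrier G; u \<in> V; g u = u\<rbrakk> \<Longrightarrow> (inv g) u = u"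
  using inv_act[of g u] by simp

lemma lift_inv:
  assumes x: "lift i x g"
  shows "lift i (inv x) (inv g)"
  using liftD[OF x] by (intro liftI) (simp_all add: intertwine_inv inv_fix)

text \<open>An element \<open>h'\<close> that induces \<open>h\<close> on the subtree at \<open>vx i\<close> need not be a lift of \<open>h\<close>; conjugation
  by it nevertheless induces conjugation by \<open>h\<close>.\<close>
lemma lift_conj:
  assumes x: "lift i x g" and h: "h \<in> carrier G" "h' \<in> carrier G"
    and int: "\<And>u. u \<in> V \<Longrightarrow> h' (fp i u) = fp i (h u)"
  shows "lift i (h \<otimes> x \<otimes> inv h) (h' \<otimes> g \<otimes> inv h')"
proof (rule liftI)
  note L = liftD[OF x]
  show "(h' \<otimes> g \<otimes> inv h') (fp i u) = fp i ((h \<otimes> x \<otimes> inv h) u)" if u: "u \<in> V" for u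
    using L h u int intertwine_inv[OF h int u] by simp
  show "(h' \<otimes> g \<otimes> inv h') w = w" if w: "w \<in> V" "w \<notin> D (vx i)" for w
  proof -
    have "h' (vx i) = vx i" using int[OF root_V] h by simp
    then have "(inv h') w \<notin> D (vx i)"
      using D_act_iff[OF h(2), of "vx i" "(inv h') w"] w h by simp
    then show ?thesis using L h w by simp
  qed
qed (use liftD[OF x] h in simp_all)

lemma lift_St:
  assumes x: "lift i x g" and "x \<in> St k"
  shows "g \<in> St k"
proof -
  have "g u = u" if "u \<in> V" "lev u \<le> k" for u
    using lift_agree[OF x lift_one, of k u] St_fix[OF assms(2)] that by simp
  then show ?thesis using liftD(2)[OF x] by (simp add: St_def)
qed

lemma lift_Suc:
  assumes x: "lift i x g" and g: "lift 1 g g'"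
  shows "lift (Suc i) x g'"
proof (rule liftI)
  note L = liftD[OF x] and L' = liftD[OF g]
  show "g' (fp (Suc i) u) = fp (Suc i) (x u)" if u: "u \<in> V" for u
    using L'(3)[of "fp i u"] L(3)[OF u] u by simp
  show "g' w = w" if w: "w \<in> V" "w \<notin> D (vx (Suc i))" for w
    using w(1)
  proof (cases rule: vx_cases[of w 1])
    case (inside u)
    then have "u \<notin> D (vx i)" using w f_D_iff[of "vx i" u] by simp
    then show ?thesis using L'(3)[of u] L(4)[of u] inside by simp
  next
    case outside
    then show ?thesis using L'(4) w by blast
  qed
qed (use liftD[OF x] liftD[OF g] in simp_all)

text \<open>The elements that have a lift to the subtree at \<open>f root\<close>.\<close>
definition liftable :: "('a \<Rightarrow> 'a) set" where "liftable = {x. \<exists>g. lift 1 x g}"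

lemma liftable_subgroup: "subgroup liftable G"
proof (rule subgroupI)
  show "liftable \<subseteq> carrier G" unfolding liftable_def using liftD(1) by blast
  show "liftable \<noteq> {}" unfolding liftable_def using lift_one by blast
  show "inv a \<in> liftable" if "a \<in> liftable" for a using that lift_inv unfolding liftable_def by blast
  show "a \<otimes> b \<in> liftable" if "a \<in> liftable" "b \<in> liftable" for a b using that lift_mult unfolding liftable_def by blast
qed

lemma liftable_lev_closed: "lev_closed liftable"
  unfolding lev_closed_def
proof (intro conjI ballI impI)
  show "liftable \<subseteq> carrier G" using subgroup.subset[OF liftable_subgroup] .
  fix x assume x: "x \<in> carrier G" and ap: "\<forall>k. \<exists>c\<in>liftable. \<forall>u\<in>V. lev u \<le> k \<longrightarrow> c u = x u"
  define h where "h = restrict (\<lambda>w. if w \<in> D (f root) then f (x (inv_into V f w)) else w) V"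
  have h1: "h (f u) = f (x u)" if u: "u \<in> V" for u
    using u bij_betwE[OF f_bij] inv_into_f_f[OF f_inj u] by (simp add: h_def)
  have h2: "h w = w" if "w \<in> V" "w \<notin> D (f root)" for w
    using that by (simp add: h_def)
  have "h \<in> carrier G"
  proof (rule complete)
    show "h \<in> extensional V" by (simp add: h_def)
    fix k
    obtain c where c: "c \<in> liftable" "\<And>u. \<lbrakk>u \<in> V; lev u \<le> k\<rbrakk> \<Longrightarrow> c u = x u" using ap by blast
    then obtain g where g: "lift 1 c g" by (auto simp: liftable_def)
    have "h w = g w" if w: "w \<in> V" "lev w \<le> k" for w
      using w(1)
    proof (cases rule: vx_cases[of w 1])
      case (inside u)
      then have "lev u \<le> k" using w by (simp add: lev_f)
      then show ?thesis using inside c(2)[of u] liftD(3)[OF g, of u] h1[of u] by simp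
    next
      case outside
      then show ?thesis using w h2[of w] liftD(4)[OF g, of w] by simp
    qed
    then show "\<exists>g\<in>carrier G. \<forall>u\<in>V. lev u \<le> k \<longrightarrow> h u = g u"
      using liftD(2)[OF g] by blast
  qed
  then have "lift 1 x h" using x h1 h2 by (intro liftI) simp_all
  then show "x \<in> liftable" by (auto simp: liftable_def)
qed

text \<open>The set \<open>liftable\<close> is closed of finite index, so contains some \<open>St k\<close>.  Since a lift of an element of
  \<open>St k\<close> is in \<open>St k\<close> again, it can be lifted once more, and so on: \<open>G\<close> is regular branch over \<open>St k\<close>.\<close>
lemma exists_regular_level: "\<exists>k. \<forall>x\<in>St k. \<forall>i. \<exists>g. lift i x g"
proof -
  obtain F where F: "finite F" "F \<subseteq> carrier G"
    "\<forall>x\<in>carrier G. \<exists>y\<in>F. \<exists>g\<in>carrier G.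
         (\<forall>u\<in>V. g (f u) = f ((x \<otimes> inv y) u)) \<and> (\<forall>w\<in>V - D (f root). g w = w)"
    using branch by blast
  have "\<exists>y\<in>F. x \<otimes> inv y \<in> liftable" if x: "x \<in> carrier G" for x
  proof -
    obtain y g where y: "y \<in> F" "g \<in> carrier G" "\<forall>u\<in>V. g (f u) = f ((x \<otimes> inv y) u)"
        "\<forall>w\<in>V - D (f root). g w = w"
      using F(3) x by blast
    then have "lift 1 (x \<otimes> inv y) g" using F(2) x by (intro liftI) auto
    then show ?thesis using y(1) by (auto simp: liftable_def)
  qed
  from lev_closed_finite_cover_St[OF liftable_lev_closed liftable_subgroup F(1,2) this]
  obtain k where k: "St k \<subseteq> liftable" by blast
  have "\<exists>g. lift i x g" if x: "x \<in> St k" for x i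
  proof (induction i)
    case 0
    have "lift 0 x x" using St_carrier[OF x] by (intro liftI) (simp_all add: D_root)
    then show ?case by blast
  next
    case (Suc i)
    then obtain g where g: "lift i x g" by blast
    then have "g \<in> liftable" using lift_St[OF g x] k by blast
    then obtain g' where "lift 1 g g'" by (auto simp: liftable_def)
    then show ?case using lift_Suc[OF g] by blast
  qed
  then show ?thesis by blast
qed

section \<open>Normal subgroups and level stabilisers\<close>

lemma support_stable:
  assumes "a \<in> carrier G" "\<And>u. \<lbrakk>u \<in> V; u \<notin> A\<rbrakk> \<Longrightarrow> a u = u" "u \<in> V" "u \<in> A"
  shows "a u \<in> A"
proof (rule ccontr)
  assume "a u \<notin> A"
  then have "a (a u) = a u" using assms by simp
  then have "a u = u" using act_eq_iff[OF assms(1) act_closed[OF assms(1,3)] assms(3)] by simp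
  then show False using \<open>a u \<notin> A\<close> assms(4) by simp
qed

lemma disjoint_support_commute:
  assumes a: "a \<in> carrier G" "\<And>u. \<lbrakk>u \<in> V; u \<notin> A\<rbrakk> \<Longrightarrow> a u = u"
    and b: "b \<in> carrier G" "\<And>u. \<lbrakk>u \<in> V; u \<notin> B\<rbrakk> \<Longrightarrow> b u = u"
    and dis: "A \<inter> B = {}"
  shows "a \<otimes> b = b \<otimes> a"
proof (rule act_ext)
  fix u assume u: "u \<in> V"
  consider "u \<in> A" "u \<notin> B" | "u \<in> B" "u \<notin> A" | "u \<notin> A" "u \<notin> B" using dis by blast
  then show "(a \<otimes> b) u = (b \<otimes> a) u"
  proof cases
    case 1
    then have "a u \<notin> B" using support_stable[OF a u] dis by blast
    then show ?thesis using a b u 1 by simp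
  next
    case 2
    then have "b u \<notin> A" using support_stable[OF b u] dis by blast
    then show ?thesis using a b u 2 by simp
  next
    case 3
    then show ?thesis using a b u by simp
  qed
qed (use a b in simp_all)

lemma conj_support:
  assumes "a \<in> carrier G" "\<And>u. \<lbrakk>u \<in> V; u \<notin> D w\<rbrakk> \<Longrightarrow> a u = u" "w \<in> V" "h \<in> carrier G"
    "u \<in> V" "u \<notin> D (h w)"
  shows "(h \<otimes> a \<otimes> inv h) u = u"
proof -
  have "(inv h) u \<notin> D w" using D_act_iff[OF assms(4,3), of "(inv h) u"] assms by simp
  then show ?thesis using assms by simp
qed

lemma D_disjoint: "\<lbrakk>u \<in> V; w \<in> V; lev u = lev w; u \<noteq> w\<rbrakk> \<Longrightarrow> D u \<inter> D w = {}"
  using D_unique[of u w] by blast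

text \<open>A normal subgroup that moves a vertex \<open>u\<close> also moves every vertex of the level of \<open>u\<close>, and then all
  descendants of these, hence \<open>vx r\<close>.\<close>
lemma normal_moves_vx:
  assumes K: "K \<lhd> G" and k: "\<kappa> \<in> K" and u: "u \<in> V" "\<kappa> u \<noteq> u" "lev u \<le> r * m"
  shows "\<exists>\<kappa>'\<in>K. \<kappa>' (vx r) \<noteq> vx r"
proof -
  have kc: "\<kappa> \<in> carrier G" using subgroup.mem_carrier[OF normal_imp_subgroup[OF K] k] .
  obtain a where a: "a \<in> V" "lev a = lev u" "vx r \<in> D a"
    using D_exists[of "vx r" "lev u"] u by auto
  obtain g where g: "g \<in> carrier G" "g a = u" using act_trans[OF a(1) u(1) a(2)] by blast
  have 1: "inv g \<otimes> \<kappa> \<otimes> g \<in> K" using normal.inv_op_closed1[OF K g(1) k] .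
  have "(inv g \<otimes> \<kappa> \<otimes> g) (vx r) \<noteq> vx r"
  proof
    assume "(inv g \<otimes> \<kappa> \<otimes> g) (vx r) = vx r"
    then have "(inv g \<otimes> \<kappa> \<otimes> g) a = a"
      using fixes_ancestor[of "inv g \<otimes> \<kappa> \<otimes> g" a "vx r"] g kc a by simp
    then have "g ((inv g) (\<kappa> u)) = u" using g a kc u(1) by simp
    then show False using g kc u by simp
  qed
  with 1 show ?thesis by blast
qed

lemma exists_noncommuting:
  assumes k: "\<forall>x\<in>St k. \<forall>i. \<exists>g. lift i x g"
  shows "\<exists>x\<in>St k. \<exists>y\<in>St k. x \<otimes> y \<noteq> y \<otimes> x"
proof (rule ccontr)
  assume "\<not> ?thesis"
  then have comm: "x \<otimes> y = y \<otimes> x" if "x \<in> St k" "y \<in> St k" for x y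
    using that by blast
  obtain x where x: "x \<in> St k" "x \<noteq> \<one>" using St_nontrivial[OF infinite_G] by blast
  have xc: "x \<in> carrier G" using St_carrier[OF x(1)] .
  have "\<exists>u\<in>V. x u \<noteq> u" using moves_vertex[OF xc x(2)] .
  then obtain u where u: "u \<in> V" "x u \<noteq> u" by blast
  define r where "r = lev u"
  have "lev u \<le> r * m" using m_pos by (simp add: r_def)
  then obtain \<kappa> where \<kappa>: "\<kappa> \<in> St k" "\<kappa> (vx r) \<noteq> vx r"
    using normal_moves_vx[OF St_normal x(1) u] by blast
  have kc: "\<kappa> \<in> carrier G" using St_carrier[OF \<kappa>(1)] .
  obtain a where a: "lift r x a" using k x(1) by blast
  note L = liftD[OF a]
  have "a \<in> St k" using lift_St[OF a x(1)] .
  \<comment> \<open>The lift \<open>a\<close> would be supported both in the subtree at \<open>vx r\<close> and in its image under \<open>\<kappa>\<close>,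
    which are disjoint.\<close>
  then have "\<kappa> \<otimes> a \<otimes> inv \<kappa> = a"
    using comm[OF \<kappa>(1)] kc L(2) by (simp add: m_assoc)
  then have a': "a w = w" if "w \<in> V" "w \<notin> D (\<kappa> (vx r))" for w
    using conj_support[OF L(2) L(4) _ kc that] by simp
  have dis: "D (vx r) \<inter> D (\<kappa> (vx r)) = {}"
    using \<kappa> kc by (intro D_disjoint) auto
  have aid: "a w = w" if w: "w \<in> V" for w
    using a'[OF w] L(4)[OF w] dis by blast
  have "fp r (x u) = fp r u" using L(3)[OF u(1)] aid[of "fp r u"] u by simp
  then have "x u = u" using inj_onD[OF fp_inj] u xc by simp
  then show False using u by simp
qed

text \<open>The closed normal subgroup generated by the commutators of \<open>St k\<close> is non-trivial, so it has finite
  index and contains some \<open>St t\<close>.\<close>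
lemma exists_commutator_level:
  assumes k: "\<forall>x\<in>St k. \<forall>i. \<exists>g. lift i x g"
  shows "\<exists>t\<ge>k. \<forall>C. C \<lhd> G \<longrightarrow> lev_closed C \<longrightarrow>
    (\<forall>x\<in>St k. \<forall>y\<in>St k. x \<otimes> y \<otimes> inv x \<otimes> inv y \<in> C) \<longrightarrow> St t \<subseteq> C"
proof -
  define \<F> where "\<F> = {C. C \<lhd> G \<and> lev_closed C \<and>
    (\<forall>x\<in>St k. \<forall>y\<in>St k. x \<otimes> y \<otimes> inv x \<otimes> inv y \<in> C)}"
  define P where "P = \<Inter>\<F>"
  have "carrier G \<in> \<F>"
    using St_carrier unfolding \<F>_def lev_closed_def
    by (auto simp: normal_inv_iff subgroup_self)
  then have ne: "\<F> \<noteq> {}" and Pc: "P \<subseteq> carrier G" unfolding P_def by blast+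
  have sub: "subgroup P G"
    unfolding P_def using ne by (intro subgroups_Inter) (auto simp: \<F>_def normal_imp_subgroup)
  have "P \<lhd> G"
    unfolding normal_inv_iff
  proof (intro conjI ballI sub)
    fix x h assume x: "x \<in> carrier G" and h: "h \<in> P"
    show "x \<otimes> h \<otimes> inv x \<in> P"
      unfolding P_def
    proof
      fix C assume C: "C \<in> \<F>"
      then have "C \<lhd> G" "h \<in> C" using h by (auto simp: P_def \<F>_def)
      then show "x \<otimes> h \<otimes> inv x \<in> C" using normal.inv_op_closed2[OF _ x] by blast
    qed
  qed
  moreover have "lev_closed P"
    unfolding lev_closed_def
  proof (intro conjI ballI impI Pc)
    fix g assume g: "g \<in> carrier G" "\<forall>k. \<exists>c\<in>P. \<forall>u\<in>V. lev u \<le> k \<longrightarrow> c u = g u"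
    show "g \<in> P"
      unfolding P_def
    proof
      fix C assume C: "C \<in> \<F>"
      then have "lev_closed C" "P \<subseteq> C" by (auto simp: P_def \<F>_def)
      moreover have "\<forall>k. \<exists>c\<in>C. \<forall>u\<in>V. lev u \<le> k \<longrightarrow> c u = g u"
        using g(2) \<open>P \<subseteq> C\<close> by (meson subsetD)
      ultimately show "g \<in> C" using g(1) unfolding lev_closed_def by simp
    qed
  qed
  moreover have "P \<noteq> {\<one>}"
  proof
    assume P: "P = {\<one>}"
    obtain x y where xy: "x \<in> St k" "y \<in> St k" "x \<otimes> y \<noteq> y \<otimes> x"
      using exists_noncommuting[OF k] by blast
    have c: "x \<in> carrier G" "y \<in> carrier G" using xy St_carrier by auto
    have "x \<otimes> y \<otimes> inv x \<otimes> inv y \<in> P"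
      using xy by (auto simp: P_def \<F>_def)
    then have "x \<otimes> y \<otimes> inv x \<otimes> inv y = \<one>" using P by simp
    then have "x \<otimes> y \<otimes> inv x = y" using c by (simp add: inv_solve_right')
    then show False using xy c by (simp add: inv_solve_right')
  qed
  ultimately have "finite (rcosets P)" using just_inf by blast
  then obtain F where F: "finite F" "F \<subseteq> carrier G"
    "\<And>x. x \<in> carrier G \<Longrightarrow> \<exists>y\<in>F. x \<otimes> inv y \<in> P"
    using finite_rcosets_cover[OF _ sub] by metis
  obtain t where t: "St t \<subseteq> P"
    using lev_closed_finite_cover_St[OF \<open>lev_closed P\<close> sub F] by blast
  have "St (max t k) \<subseteq> P" using t St_antimono[of t "max t k"] by auto
  then have "St (max t k) \<subseteq> C" if "C \<in> \<F>" for C using that by (auto simp: P_def)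
  then show ?thesis by (intro exI[of _ "max t k"]) (auto simp: \<F>_def)
qed

text \<open>With \<open>a' = \<kappa> a\<inverse> \<kappa>\<inverse>\<close>, the element \<open>e = a a' = [a, \<kappa>]\<close> lies in \<open>K\<close>.  As \<open>a'\<close> is supported in the
  subtree at \<open>\<kappa> w\<close>, it commutes with \<open>b\<close>, and therefore \<open>[a, b] = [e, b] \<in> K\<close>.\<close>
lemma commutator_mem_normal:
  assumes K: "K \<lhd> G" and \<kappa>: "\<kappa> \<in> K" "\<kappa> w \<noteq> w" and w: "w \<in> V"
    and a: "a \<in> carrier G" "\<And>u. \<lbrakk>u \<in> V; u \<notin> D w\<rbrakk> \<Longrightarrow> a u = u"
    and b: "b \<in> carrier G" "\<And>u. \<lbrakk>u \<in> V; u \<notin> D w\<rbrakk> \<Longrightarrow> b u = u"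
  shows "a \<otimes> b \<otimes> inv a \<otimes> inv b \<in> K"
proof -
  have sub: "subgroup K G" using normal_imp_subgroup[OF K] .
  have kc: "\<kappa> \<in> carrier G" using subgroup.mem_carrier[OF sub \<kappa>(1)] .
  have ai: "(inv a) u = u" if "u \<in> V" "u \<notin> D w" for u using inv_fix[OF a(1)] a(2) that by simp
  define a' where "a' = \<kappa> \<otimes> inv a \<otimes> inv \<kappa>"
  have a'c: "a' \<in> carrier G" using a kc by (simp add: a'_def)
  have a's: "a' u = u" if "u \<in> V" "u \<notin> D (\<kappa> w)" for u
    unfolding a'_def using conj_support[OF inv_closed[OF a(1)] ai w kc that] .
  have "D (\<kappa> w) \<inter> D w = {}" using \<kappa> kc w by (intro D_disjoint) auto
  then have comm: "a' \<otimes> b = b \<otimes> a'"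
    using disjoint_support_commute[OF a'c a's b] by simp
  define e where "e = a \<otimes> a'"
  have ec: "e \<in> carrier G" using a a'c by (simp add: e_def)
  have eK: "e \<in> K"
  proof -
    have "e = a \<otimes> \<kappa> \<otimes> inv a \<otimes> inv \<kappa>" using a kc by (simp add: e_def a'_def m_assoc)
    moreover have "a \<otimes> \<kappa> \<otimes> inv a \<in> K" using normal.inv_op_closed2[OF K a(1) \<kappa>(1)] .
    ultimately show ?thesis
      using subgroup.m_closed[OF sub] subgroup.m_inv_closed[OF sub \<kappa>(1)] by simp
  qed
  have "b \<otimes> inv e \<otimes> inv b \<in> K"
    using normal.inv_op_closed2[OF K b(1) subgroup.m_inv_closed[OF sub eK]] .
  then have "e \<otimes> (b \<otimes> inv e \<otimes> inv b) \<in> K" using subgroup.m_closed[OF sub eK] by simp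
  moreover have "e \<otimes> (b \<otimes> inv e \<otimes> inv b) = a \<otimes> (a' \<otimes> b) \<otimes> inv a' \<otimes> inv a \<otimes> inv b"
    using a a'c b by (simp add: e_def m_assoc inv_mult_group)
  moreover have "\<dots> = a \<otimes> b \<otimes> inv a \<otimes> inv b"
    unfolding comm using a a'c b by (simp add: m_assoc inv_solve_left)
  ultimately show ?thesis by simp
qed

text \<open>The central step: an open normal subgroup \<open>K\<close> that does not fix the level \<open>r * m\<close> contains
  \<open>St (r * m + t)\<close>, where \<open>t\<close> depends neither on \<open>K\<close> nor on \<open>r\<close>.  By \<open>commutator_mem_normal\<close>, the elements of
  \<open>St k\<close> with a lift in \<open>K\<close> to the subtree at \<open>vx r\<close> form a closed normal subgroup of \<open>G\<close> containing all
  commutators of \<open>St k\<close>; hence this subgroup contains \<open>St t\<close>.  An element of \<open>St (r * m + t)\<close> is the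
  product of its restrictions to the subtrees at level \<open>r * m\<close>, and each of them is a conjugate of a
  lift of an element of \<open>St t\<close>.\<close>
lemma normal_contains_St:
  assumes k: "\<forall>x\<in>St k. \<forall>i. \<exists>g. lift i x g" and kt: "k \<le> t"
    and t: "\<And>C. \<lbrakk>C \<lhd> G; lev_closed C;
      \<forall>x\<in>St k. \<forall>y\<in>St k. x \<otimes> y \<otimes> inv x \<otimes> inv y \<in> C\<rbrakk> \<Longrightarrow> St t \<subseteq> C"
    and K: "K \<lhd> G" and op: "St k0 \<subseteq> K" and nle: "\<not> K \<subseteq> St (r * m)"
  shows "St (r * m + t) \<subseteq> K"
proof -
  have sub: "subgroup K G" using normal_imp_subgroup[OF K] .
  have Stsub: "subgroup (St k) G" using normal_imp_subgroup[OF St_normal] .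
  obtain \<kappa>0 where k0: "\<kappa>0 \<in> K" "\<kappa>0 \<notin> St (r * m)" using nle by blast
  then obtain u0 where u0: "u0 \<in> V" "\<kappa>0 u0 \<noteq> u0" "lev u0 \<le> r * m"
    using subgroup.mem_carrier[OF sub k0(1)] by (auto simp: St_def)
  obtain \<kappa> where \<kappa>: "\<kappa> \<in> K" "\<kappa> (vx r) \<noteq> vx r"
    using normal_moves_vx[OF K k0(1) u0] by blast
  define C where "C = {x \<in> St k. \<exists>g\<in>K. lift r x g}"
  have Csub: "subgroup C G"
  proof (rule subgroupI)
    show "C \<subseteq> carrier G" using St_carrier by (auto simp: C_def)
    have "\<one> \<in> C"
      using lift_one subgroup.one_closed[OF sub] subgroup.one_closed[OF Stsub] by (auto simp: C_def)
    then show "C \<noteq> {}" by blast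
    show "inv x \<in> C" if "x \<in> C" for x
      using that lift_inv subgroup.m_inv_closed[OF sub] subgroup.m_inv_closed[OF Stsub]
      unfolding C_def by blast
    show "x \<otimes> y \<in> C" if "x \<in> C" "y \<in> C" for x y
      using that lift_mult subgroup.m_closed[OF sub] subgroup.m_closed[OF Stsub]
      unfolding C_def by blast
  qed
  have "C \<lhd> G"
    unfolding normal_inv_iff
  proof (intro conjI ballI Csub)
    fix h x assume h: "h \<in> carrier G" and x: "x \<in> C"
    then obtain g where g: "x \<in> St k" "g \<in> K" "lift r x g" by (auto simp: C_def)
    obtain h' where h': "h' \<in> carrier G" "\<And>u. u \<in> V \<Longrightarrow> h' (fp r u) = fp r (h u)"
      using fp_extend[OF h, of r] by blast
    have "h \<otimes> x \<otimes> inv h \<in> St k" using normal.inv_op_closed2[OF St_normal h g(1)] .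
    moreover have "h' \<otimes> g \<otimes> inv h' \<in> K" using normal.inv_op_closed2[OF K h'(1) g(2)] .
    moreover have "lift r (h \<otimes> x \<otimes> inv h) (h' \<otimes> g \<otimes> inv h')"
      using lift_conj[OF g(3) h h'] .
    ultimately show "h \<otimes> x \<otimes> inv h \<in> C" by (auto simp: C_def)
  qed
  moreover have "lev_closed C"
    unfolding lev_closed_def
  proof (intro conjI ballI impI)
    show "C \<subseteq> carrier G" using subgroup.subset[OF Csub] .
    fix x assume x: "x \<in> carrier G" and ap: "\<forall>l. \<exists>c\<in>C. \<forall>u\<in>V. lev u \<le> l \<longrightarrow> c u = x u"
    obtain c where c: "c \<in> C" "\<And>u. \<lbrakk>u \<in> V; lev u \<le> max k k0\<rbrakk> \<Longrightarrow> c u = x u"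
      using ap by blast
    obtain h where h: "c \<in> St k" "h \<in> K" "lift r c h" using c(1) by (auto simp: C_def)
    have xk: "x \<in> St k" using x c(2) St_fix[OF h(1)] by (auto simp: St_def)
    then obtain g where g: "lift r x g" using k by blast
    have "g w = h w" if "w \<in> V" "lev w \<le> k0" for w
      using lift_agree[OF g h(3), of k0 w] c(2) that by simp
    then have "g \<in> K" using agree_mem[OF sub op liftD(2)[OF g] h(2)] by blast
    then show "x \<in> C" using xk g by (auto simp: C_def)
  qed
  moreover have "\<forall>x\<in>St k. \<forall>y\<in>St k. x \<otimes> y \<otimes> inv x \<otimes> inv y \<in> C"
  proof (intro ballI)
    fix x y assume xy: "x \<in> St k" "y \<in> St k"
    obtain a b where a: "lift r x a" and b: "lift r y b" using k xy by blast
    have "a \<otimes> b \<otimes> inv a \<otimes> inv b \<in> K"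
      using commutator_mem_normal[OF K \<kappa> _ liftD(2,4)[OF a] liftD(2,4)[OF b]] by simp
    moreover have "lift r (x \<otimes> y \<otimes> inv x \<otimes> inv y) (a \<otimes> b \<otimes> inv a \<otimes> inv b)"
      using a b by (intro lift_mult lift_inv)
    moreover have "x \<otimes> y \<otimes> inv x \<otimes> inv y \<in> St k"
      using xy by (intro subgroup.m_closed[OF Stsub] subgroup.m_inv_closed[OF Stsub])
    ultimately show "x \<otimes> y \<otimes> inv x \<otimes> inv y \<in> C" by (auto simp: C_def)
  qed
  ultimately have tC: "St t \<subseteq> C" by (rule t)
  show ?thesis
  proof
    fix g assume g: "g \<in> St (r * m + t)"
    have gc: "g \<in> carrier G" using St_carrier[OF g] .
    have g': "g \<in> St (r * m)" using g St_antimono[of "r * m" "r * m + t"] by auto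
    show "g \<in> K"
    proof (rule glue_St[OF sub g'])
      fix w assume "w \<in> level (r * m)"
      then have w: "w \<in> V" "lev w = r * m" by (auto simp: level_def)
      obtain h where h: "h \<in> carrier G" "h (vx r) = w" using act_trans[of "vx r" w] w by auto
      have "(inv h \<otimes> g \<otimes> h) (vx r) = vx r"
        using h gc w St_fix[OF g' w(1)] inv_act[OF h(1), of "vx r"] by simp
      then obtain x where x: "x \<in> carrier G" "\<And>u. u \<in> V \<Longrightarrow> (inv h \<otimes> g \<otimes> h) (fp r u) = fp r (x u)"
        using fp_restrict[of "inv h \<otimes> g \<otimes> h" r] h gc by auto
      have "x u = u" if u: "u \<in> V" "lev u \<le> t" for u
      proof -
        have "g (h (fp r u)) = h (fp r u)"
          using St_fix[OF g] h u by (simp add: lev_fp)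
        then have "fp r (x u) = fp r u" using x(2)[OF u(1)] h gc u by simp
        then show ?thesis using inj_onD[OF fp_inj] u x(1) by simp
      qed
      then have "x \<in> St t" using x(1) by (simp add: St_def)
      then obtain e where e: "e \<in> K" "lift r x e" using tC by (auto simp: C_def)
      have ec: "e \<in> carrier G" using liftD(2)[OF e(2)] .
      show "\<exists>e\<in>K. (\<forall>u\<in>D w. e u = g u) \<and> (\<forall>u\<in>V - D w. e u = u)"
      proof (intro bexI conjI ballI)
        show "h \<otimes> e \<otimes> inv h \<in> K" using normal.inv_op_closed2[OF K h(1) e(1)] .
        show "(h \<otimes> e \<otimes> inv h) u = u" if "u \<in> V - D w" for u
          using conj_support[OF ec liftD(4)[OF e(2)] fp_V[OF root_V] h(1), where u = u] that h(2) by simp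
        fix u assume u: "u \<in> D w"
        then have uV: "u \<in> V" using w by blast
        have "(inv h) u \<in> D (vx r)" using D_act_iff[OF h(1), of "vx r" "(inv h) u"] u h uV by simp
        then obtain z where z: "z \<in> V" "(inv h) u = fp r z" using fp_image_V[of r] by auto
        have "(h \<otimes> e \<otimes> inv h) u = h (e (fp r z))" using h ec uV z by simp
        also have "\<dots> = h ((inv h \<otimes> g \<otimes> h) (fp r z))"
          using x(2)[OF z(1)] liftD(3)[OF e(2) z(1)] by simp
        also have "\<dots> = g (h (fp r z))" using h gc z by simp
        also have "h (fp r z) = u" using z h uV by (metis act_inv)
        finally show "(h \<otimes> e \<otimes> inv h) u = g u" .
      qed
    qed
  qed
qed

section \<open>Counting vertices and actions on balls\<close>

text \<open>For every vertex \<open>w\<close> of level \<open>m\<close>, a fixed element of \<open>G\<close> that moves \<open>f root\<close> to \<open>w\<close>.  Thus \<open>carry w\<close>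
  after \<open>f\<close> identifies the tree with the subtree at \<open>w\<close>.\<close>
definition carry :: "'a \<Rightarrow> 'a \<Rightarrow> 'a" where
  "carry w = (SOME h. h \<in> carrier G \<and> h (f root) = w)"

lemma carry:
  assumes "w \<in> level m"
  shows "carry w \<in> carrier G" "carry w (f root) = w"
proof -
  have "\<exists>h. h \<in> carrier G \<and> h (f root) = w"
    using act_trans[OF f_root_V, of w] assms by (auto simp: level_def m_def)
  from someI_ex[OF this] show "carry w \<in> carrier G" "carry w (f root) = w"
    by (simp_all add: carry_def)
qed

lemma carry_below:
  assumes w: "w \<in> level m" and u: "u \<in> V"
  shows "carry w (f u) \<in> D w" "lev (carry w (f u)) = m + lev u"
proof -
  have "f u \<in> D (f root)" using f_D[OF root_V, of u] u by (simp add: D_root)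
  then show "carry w (f u) \<in> D w" using D_act[OF carry(1)[OF w] f_root_V] carry(2)[OF w] by simp
  show "lev (carry w (f u)) = m + lev u" using carry(1)[OF w] u by (simp add: lev_f)
qed

lemma below_level_m_cases:
  assumes z: "z \<in> V" "m \<le> lev z"
  obtains w u where "w \<in> level m" "u \<in> V" "z = carry w (f u)"
proof -
  obtain w where w: "w \<in> V" "lev w = m" "z \<in> D w" using D_exists[OF z] by blast
  then have wl: "w \<in> level m" by (simp add: level_def)
  note h = carry[OF wl]
  have "(inv (carry w)) z \<in> D (f root)"
    using D_act_iff[OF h(1) f_root_V, of "(inv (carry w)) z"] h w z by simp
  then obtain u where u: "u \<in> V" "(inv (carry w)) z = f u"
    using f_bij by (auto simp: bij_betw_def)
  have "z = carry w (f u)" unfolding u(2)[symmetric] using h(1) z by simp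
  then show thesis using that wl u by blast
qed

lemma card_level_add: "card (level (m + k)) = card (level m) * card (level k)"
proof -
  have "bij_betw (\<lambda>(w, u). carry w (f u)) (level m \<times> level k) (level (m + k))"
    unfolding bij_betw_def
  proof
    show "inj_on (\<lambda>(w, u). carry w (f u)) (level m \<times> level k)"
    proof (rule inj_onI, clarify)
      fix w u w' u'
      assume w: "w \<in> level m" and w': "w' \<in> level m" and u: "u \<in> level k" "u' \<in> level k"
        and eq: "carry w (f u) = carry w' (f u')"
      have V: "u \<in> V" "u' \<in> V" "w \<in> V" "w' \<in> V" "lev w = lev w'"
        using w w' u by (simp_all add: level_def)
      have ww: "w = w'"
        using D_unique[OF V(3,4) carry_below(1)[OF w V(1)] _ V(5)] carry_below(1)[OF w' V(2)] eq by simp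
      moreover have "f u = f u'"
        using eq act_eq_iff[OF carry(1)[OF w'] f_V[OF V(1)] f_V[OF V(2)]] by (simp add: ww)
      ultimately show "w = w' \<and> u = u'" using inj_onD[OF f_inj _ V(1,2)] by simp
    qed
    show "(\<lambda>(w, u). carry w (f u)) ` (level m \<times> level k) = level (m + k)"
    proof
      show "(\<lambda>(w, u). carry w (f u)) ` (level m \<times> level k) \<subseteq> level (m + k)"
        using carry(1) by (auto simp: level_def lev_f)
      show "level (m + k) \<subseteq> (\<lambda>(w, u). carry w (f u)) ` (level m \<times> level k)"
      proof
        fix z assume "z \<in> level (m + k)"
        then have z: "z \<in> V" "lev z = m + k" by (simp_all add: level_def)
        then obtain w u where wu: "w \<in> level m" "u \<in> V" "z = carry w (f u)"
          using below_level_m_cases[of z] by auto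
        then have "u \<in> level k" using carry_below(2)[OF wu(1,2)] z by (simp add: level_def)
        then show "z \<in> (\<lambda>(w, u). carry w (f u)) ` (level m \<times> level k)" using wu by force
      qed
    qed
  qed
  then show ?thesis using bij_betw_same_card by (fastforce simp: card_cartesian_product)
qed

lemma finite_level: "finite (level k)"
  unfolding level_def by (rule finite_layer)

lemma card_level: "card (level (r * m)) = card (level m) ^ r"
proof (induction r)
  case 0
  have "level 0 = {root}" using eq_root_if_lev_0 by (auto simp: level_def)
  then show ?case by simp
next
  case (Suc r)
  then show ?case using card_level_add[of "r * m"] by simp
qed

lemma card_level_ge2: "2 \<le> card (level m)"
proof (rule ccontr)
  assume "\<not> ?thesis"
  then have le: "card (level m) \<le> 1" by simp
  obtain x where x: "x \<in> St 0" "x \<noteq> \<one>" using St_nontrivial[OF infinite_G, of 0] by blast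
  have xc: "x \<in> carrier G" using St_carrier[OF x(1)] .
  have "\<exists>u\<in>V. x u \<noteq> u" using moves_vertex[OF xc x(2)] .
  then obtain u where u: "u \<in> V" "x u \<noteq> u" by blast
  have "lev u \<le> lev u * m" using m_pos by simp
  then obtain \<kappa> where \<kappa>: "\<kappa> \<in> St 0" "\<kappa> (vx (lev u)) \<noteq> vx (lev u)"
    using normal_moves_vx[OF St_normal x(1) u] by blast
  have "card {vx (lev u), \<kappa> (vx (lev u))} \<le> card (level (lev u * m))"
    using St_carrier[OF \<kappa>(1)] by (intro card_mono finite_level) (simp add: level_def)
  then have "2 \<le> card (level m) ^ lev u" using \<kappa>(2) by (simp add: card_level)
  also have "\<dots> \<le> 1" using power_mono[OF le, of "lev u"] by simp
  finally show False by simp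
qed

text \<open>Under the identifications given by \<open>carry\<close>, every \<open>g\<close> maps the subtree at \<open>w\<close> to the subtree at \<open>g w\<close>
  as some element of \<open>G\<close> acts on the tree.\<close>
lemma exists_section:
  assumes g: "g \<in> carrier G" and w: "w \<in> level m"
  shows "\<exists>x\<in>carrier G. \<forall>u\<in>V. g (carry w (f u)) = carry (g w) (f (x u))"
proof -
  have gw: "g w \<in> level m" using g w by (simp add: level_def)
  define e where "e = inv (carry (g w)) \<otimes> g \<otimes> carry w"
  have ec: "e \<in> carrier G" using g carry(1)[OF w] carry(1)[OF gw] by (simp add: e_def)
  have e: "e z = (inv (carry (g w))) (g (carry w z))" if "z \<in> V" for z
    using that g carry(1)[OF w] carry(1)[OF gw] by (simp add: e_def)
  have "e (f root) = f root"
    using e[OF f_root_V] carry(2)[OF w] carry(2)[OF gw] inv_act[OF carry(1)[OF gw] f_root_V] by simp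
  then obtain x where x: "x \<in> carrier G" "\<forall>u\<in>V. e (f u) = f (x u)"
    using f_restrict[OF ec] by blast
  have "g (carry w (f u)) = carry (g w) (f (x u))" if u: "u \<in> V" for u
  proof -
    have "f (x u) = (inv (carry (g w))) (g (carry w (f u)))" using x(2) e[of "f u"] u by simp
    then show ?thesis using act_inv[OF carry(1)[OF gw], of "g (carry w (f u))"] g carry(1)[OF w] u by simp
  qed
  then show ?thesis using x(1) by blast
qed

text \<open>The action of \<open>g\<close> on \<open>ball (m + k)\<close> is determined by its action on \<open>ball m\<close> and by the action on
  \<open>ball k\<close> of its sections at the vertices of level \<open>m\<close>.\<close>
lemma card_germs_add: "card (germs (m + k)) \<le> card (germs m) * card (germs k) ^ card (level m)"
proof -
  define sec where "sec = (\<lambda>g w. SOME x. x \<in> carrier G \<and>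
    (\<forall>u\<in>V. g (carry w (f u)) = carry (g w) (f (x u))))"
  have sec: "sec g w \<in> carrier G" "\<And>u. u \<in> V \<Longrightarrow> g (carry w (f u)) = carry (g w) (f (sec g w u))"
    if "g \<in> carrier G" "w \<in> level m" for g w
  proof -
    have "\<exists>x. x \<in> carrier G \<and> (\<forall>u\<in>V. g (carry w (f u)) = carry (g w) (f (x u)))"
      using exists_section[OF that] by blast
    from someI_ex[OF this]
    have "sec g w \<in> carrier G \<and> (\<forall>u\<in>V. g (carry w (f u)) = carry (g w) (f (sec g w u)))"
      unfolding sec_def .
    then show "sec g w \<in> carrier G" "\<And>u. u \<in> V \<Longrightarrow> g (carry w (f u)) = carry (g w) (f (sec g w u))"
      by blast+
  qed
  define \<Psi> where "\<Psi> = (\<lambda>g. (restrict g (ball m), \<lambda>w\<in>level m. restrict (sec g w) (ball k)))"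
  have det: "restrict g (ball (m + k)) = restrict h (ball (m + k))"
    if gh: "g \<in> carrier G" "h \<in> carrier G" "\<Psi> g = \<Psi> h" for g h
  proof (rule restrict_ext)
    fix z assume "z \<in> ball (m + k)"
    then have z: "z \<in> V" "lev z \<le> m + k" by (simp_all add: ball_def)
    have eqs: "restrict g (ball m) = restrict h (ball m) \<and>
        (\<lambda>w\<in>level m. restrict (sec g w) (ball k)) = (\<lambda>w\<in>level m. restrict (sec h w) (ball k))"
      using gh(3) unfolding \<Psi>_def prod.inject .
    have 1: "g u = h u" if "u \<in> V" "lev u \<le> m" for u
      by (rule restrict_eqD[OF conjunct1[OF eqs]]) (simp add: ball_def that)
    show "g z = h z"
    proof (cases "m \<le> lev z")
      case True
      then obtain w u where wu: "w \<in> level m" "u \<in> V" "z = carry w (f u)"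
        using below_level_m_cases[OF z(1)] by blast
      have "u \<in> ball k" using carry_below(2)[OF wu(1,2)] wu z by (simp add: ball_def)
      moreover have "restrict (sec g w) (ball k) = restrict (sec h w) (ball k)"
        by (rule restrict_eqD[OF conjunct2[OF eqs] wu(1)])
      ultimately have "sec g w u = sec h w u" by (intro restrict_eqD)
      moreover have "g w = h w" using 1[of w] wu(1) by (simp add: level_def)
      ultimately show ?thesis
        using sec(2)[OF gh(1) wu(1,2)] sec(2)[OF gh(2) wu(1,2)] wu(3) by simp
    qed (use 1 z in simp)
  qed
  have \<Psi>: "\<Psi> ` carrier G \<subseteq> germs m \<times> (\<Pi>\<^sub>E w\<in>level m. germs k)"
  proof (rule image_subsetI)
    fix g assume g: "g \<in> carrier G"
    have "restrict (sec g w) (ball k) \<in> germs k" if "w \<in> level m" for w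
      using sec(1)[OF g that] by (simp add: germs_def)
    moreover have "restrict g (ball m) \<in> germs m" using g by (simp add: germs_def)
    ultimately show "\<Psi> g \<in> germs m \<times> (\<Pi>\<^sub>E w\<in>level m. germs k)"
      unfolding \<Psi>_def by (intro SigmaI restrict_PiE_iff[THEN iffD2] ballI)
  qed
  have fin: "finite (germs m \<times> (\<Pi>\<^sub>E w\<in>level m. germs k))"
    by (intro finite_cartesian_product finite_PiE finite_germs finite_level)
  define \<Theta> where "\<Theta> = (\<lambda>y. restrict (SOME g. g \<in> carrier G \<and> \<Psi> g = y) (ball (m + k)))"
  have "germs (m + k) \<subseteq> \<Theta> ` \<Psi> ` carrier G"
  proof
    fix e assume "e \<in> germs (m + k)"
    then obtain g where g: "g \<in> carrier G" "e = restrict g (ball (m + k))" by (auto simp: germs_def)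
    have some: "(SOME h. h \<in> carrier G \<and> \<Psi> h = \<Psi> g) \<in> carrier G \<and>
        \<Psi> (SOME h. h \<in> carrier G \<and> \<Psi> h = \<Psi> g) = \<Psi> g"
      by (rule someI[of _ g]) (simp add: g(1))
    have "\<Theta> (\<Psi> g) = e"
      unfolding \<Theta>_def g(2) by (intro det conjunct1[OF some] g(1) conjunct2[OF some])
    then show "e \<in> \<Theta> ` \<Psi> ` carrier G" using g(1) by blast
  qed
  then have "card (germs (m + k)) \<le> card (\<Psi> ` carrier G)"
    by (rule surj_card_le[OF finite_subset[OF \<Psi> fin]])
  also have "\<dots> \<le> card (germs m \<times> (\<Pi>\<^sub>E w\<in>level m. germs k))" by (rule card_mono[OF fin \<Psi>])
  also have "\<dots> = card (germs m) * card (germs k) ^ card (level m)"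
    by (simp add: card_cartesian_product card_PiE[OF finite_level])
  finally show ?thesis .
qed

text \<open>The exponent \<open>e r\<close> obtained from \<open>card_germs_add\<close> satisfies \<open>e (r + 1) = 1 + d * e r\<close>, where \<open>d\<close> is
  the number of vertices of level \<open>m\<close>.  The induction uses \<open>e r + 1 \<le> d ^ r\<close>, which needs \<open>d \<ge> 2\<close>.\<close>
lemma card_germs_le: "card (germs (r * m)) \<le> card (germs m) ^ (card (level m) ^ r)"
proof -
  let ?q = "card (germs m)" and ?d = "card (level m)"
  have q: "1 \<le> ?q" by (rule card_germs_pos)
  have "\<exists>e. e + 1 \<le> ?d ^ r \<and> card (germs (r * m)) \<le> ?q ^ e"
  proof (induction r)
    case 0
    have b: "ball 0 = {root}" using eq_root_if_lev_0 by (auto simp: ball_def)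
    have "germs 0 \<subseteq> {restrict \<one> (ball 0)}"
      unfolding germs_def b by (auto intro!: restrict_ext)
    then have "card (germs 0) \<le> 1" using card_mono[of "{restrict \<one> (ball 0)}"] by fastforce
    then show ?case by (intro exI[of _ 0]) simp
  next
    case (Suc r)
    then obtain e where e: "e + 1 \<le> ?d ^ r" "card (germs (r * m)) \<le> ?q ^ e" by blast
    have "card (germs (Suc r * m)) \<le> ?q * (?q ^ e) ^ ?d"
      using card_germs_add[of "r * m"] e(2) power_mono[OF e(2), of ?d]
      by (simp add: order_trans[OF _ mult_le_mono2])
    also have "\<dots> = ?q ^ (1 + e * ?d)" by (simp add: power_mult power_add)
    finally have "card (germs (Suc r * m)) \<le> ?q ^ (1 + e * ?d)" .
    moreover have "1 + e * ?d + 1 \<le> (e + 1) * ?d" using card_level_ge2 by simp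
    moreover have "(e + 1) * ?d \<le> ?d ^ Suc r" using mult_le_mono1[OF e(1), of ?d] by (simp add: mult.commute)
    ultimately show ?case by (intro exI[of _ "1 + e * ?d"]) linarith
  qed
  then obtain e where "e + 1 \<le> ?d ^ r" "card (germs (r * m)) \<le> ?q ^ e" by blast
  moreover from this have "?q ^ e \<le> ?q ^ (?d ^ r)" using q by (intro power_increasing) simp_all
  ultimately show ?thesis by simp
qed

text \<open>The bound without reference to the topology.  The first clause about \<open>K\<close> says that \<open>St s'\<close> is contained in all
  open normal subgroups of index at most \<open>n\<close>, the second one that \<open>St s\<close> is contained in those open
  normal subgroups that are not contained in \<open>St s'\<close>; so the index of \<open>St s\<close> is a bound for \<open>ob(n)\<close>.\<close>
theorem obliquity_bound:
  "\<exists>c. \<forall>n\<ge>1. \<exists>s s'. s' \<le> s \<and> card (germs s) \<le> c ^ n \<and>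
     (\<forall>K k. K \<lhd> G \<longrightarrow> St k \<subseteq> K \<longrightarrow> finite (rcosets K) \<longrightarrow> card (rcosets K) \<le> n \<longrightarrow> St s' \<subseteq> K) \<and>
     (\<forall>K k. K \<lhd> G \<longrightarrow> St k \<subseteq> K \<longrightarrow> \<not> K \<subseteq> St s' \<longrightarrow> St s \<subseteq> K)"
proof -
  let ?q = "card (germs m)" and ?d = "card (level m)"
  have q: "1 \<le> ?q" by (rule card_germs_pos)
  obtain k where k: "\<forall>x\<in>St k. \<forall>i. \<exists>g. lift i x g" using exists_regular_level by blast
  obtain t where t: "k \<le> t" "\<And>C. \<lbrakk>C \<lhd> G; lev_closed C;
      \<forall>x\<in>St k. \<forall>y\<in>St k. x \<otimes> y \<otimes> inv x \<otimes> inv y \<in> C\<rbrakk> \<Longrightarrow> St t \<subseteq> C"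
    using exists_commutator_level[OF k] by blast
  have contains: "St (r * m + t) \<subseteq> K"
    if "K \<lhd> G" "St l \<subseteq> K" "\<not> K \<subseteq> St (r * m)" for K l r
    by (rule normal_contains_St[OF k t(1) _ that]) (rule t(2))
  show ?thesis
  proof (rule exI[of _ "?q ^ (?d ^ (1 + 2 * t))"], intro allI impI)
    fix n :: nat assume n: "1 \<le> n"
    obtain p where p: "?d ^ p \<le> n" "n < ?d ^ (p + 1)"
      using ex_power_ivl1[OF card_level_ge2 n] by blast
    \<comment> \<open>An open normal subgroup of index at most \<open>n\<close> moves the level \<open>(p + 1) * m\<close>, which explains \<open>s'\<close>.
      The multiple \<open>(p + 1 + t) * m\<close> of \<open>m\<close> is at least \<open>s'\<close>, and \<open>s\<close> leaves room for a further shift by \<open>t\<close>.\<close>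
    define s' s where "s' = (p + 1) * m + t" and "s = (p + 1 + 2 * t) * m"
    have tm: "t \<le> t * m" using m_pos by simp
    have "s' \<le> (p + 1 + t) * m" unfolding s'_def using tm by (simp add: add_mult_distrib)
    moreover have s2: "(p + 1 + t) * m + t \<le> s" unfolding s_def using tm by (simp add: add_mult_distrib)
    ultimately have ss: "s' \<le> s" by simp
    have "card (germs s) \<le> ?q ^ (?d ^ (p + 1 + 2 * t))" unfolding s_def by (rule card_germs_le)
    also have "?d ^ (p + 1 + 2 * t) = ?d ^ (1 + 2 * t) * ?d ^ p" by (simp add: power_add)
    also have "?q ^ \<dots> \<le> ?q ^ (?d ^ (1 + 2 * t) * n)"
      using q p(1) by (intro power_increasing mult_le_mono2) simp_all
    also have "\<dots> = (?q ^ (?d ^ (1 + 2 * t))) ^ n" by (rule power_mult)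
    finally have germs: "card (germs s) \<le> (?q ^ (?d ^ (1 + 2 * t))) ^ n" .
    have small: "St s' \<subseteq> K"
      if K: "K \<lhd> G" "St l \<subseteq> K" and fin: "finite (rcosets K)" "card (rcosets K) \<le> n" for K l
    proof -
      have sub: "subgroup K G" using normal_imp_subgroup[OF K(1)] .
      have "\<exists>r. \<not> K \<subseteq> St (r * m)"
      proof (rule ccontr)
        assume "\<not> ?thesis"
        then have all: "K \<subseteq> St (r * m)" for r by blast
        have "x = \<one>" if x: "x \<in> K" for x
        proof (rule act_ext)
          show "x u = \<one> u" if u: "u \<in> V" for u
            using all[of "lev u"] x St_fix[of x "lev u * m" u] u m_pos by auto
        qed (use x subgroup.mem_carrier[OF sub] in simp_all)
        then have K1: "K \<subseteq> {\<one>}" by blast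
        obtain F where F: "finite F" "F \<subseteq> carrier G"
            "\<And>x. x \<in> carrier G \<Longrightarrow> \<exists>y\<in>F. x \<otimes> inv y \<in> K"
          using finite_rcosets_cover[OF fin(1) sub] by metis
        have "carrier G \<subseteq> F"
        proof
          fix x assume x: "x \<in> carrier G"
          then obtain y where y: "y \<in> F" "x \<otimes> inv y \<in> K" using F(3) by blast
          have "x \<otimes> inv y = \<one>" "y \<in> carrier G" using y K1 F(2) by auto
          then have "x = y" using x by (simp add: inv_solve_right')
          then show "x \<in> F" using y by simp
        qed
        then show False using infinite_G F(1) finite_subset by blast
      qed
      then obtain r where r: "\<not> K \<subseteq> St (r * m)" "\<And>j. j < r \<Longrightarrow> K \<subseteq> St (j * m)"
        using exists_least_iff[of "\<lambda>r. \<not> K \<subseteq> St (r * m)"] by blast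
      have "r \<noteq> 0" using r(1) subgroup.subset[OF sub] by (auto simp: St_0)
      then obtain r' where r': "r = Suc r'" by (cases r) auto
      have "K \<subseteq> St (r' * m)" using r(2) r' by simp
      \<comment> \<open>By minimality of \<open>r\<close>, the group \<open>K\<close> fixes the level \<open>r' * m\<close>, which has \<open>d ^ r'\<close> vertices.\<close>
      then have "card (level (r' * m)) \<le> card (rcosets K)"
        by (rule card_level_le_index[OF sub _ fin(1), of _ "vx r'"]) (simp add: level_def)
      then have "?d ^ r' < ?d ^ (p + 1)" using fin(2) p(2) by (simp add: card_level)
      then have "r' < p + 1" using card_level_ge2 power_less_imp_less_exp[of ?d r' "p + 1"] by simp
      then have "r * m \<le> (p + 1) * m" using r' by (simp only: mult_le_mono1 Suc_eq_plus1 less_eq_Suc_le)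
      then have "St s' \<subseteq> St (r * m + t)" unfolding s'_def by (intro St_antimono) simp
      also have "\<dots> \<subseteq> K" by (rule contains[OF K r(1)])
      finally show ?thesis .
    qed
    have big: "St s \<subseteq> K" if K: "K \<lhd> G" "St l \<subseteq> K" and nle: "\<not> K \<subseteq> St s'" for K l
    proof -
      have "\<not> K \<subseteq> St ((p + 1 + t) * m)"
        using nle St_antimono[OF \<open>s' \<le> (p + 1 + t) * m\<close>] by blast
      then have "St ((p + 1 + t) * m + t) \<subseteq> K" by (rule contains[OF K])
      then show ?thesis using St_antimono[OF s2] by blast
    qed
    show "\<exists>s s'. s' \<le> s \<and> card (germs s) \<le> (?q ^ (?d ^ (1 + 2 * t))) ^ n \<and>
       (\<forall>K k. K \<lhd> G \<longrightarrow> St k \<subseteq> K \<longrightarrow> finite (rcosets K) \<longrightarrow> card (rcosets K) \<le> n \<longrightarrow> St s' \<subseteq> K) \<and>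
       (\<forall>K k. K \<lhd> G \<longrightarrow> St k \<subseteq> K \<longrightarrow> \<not> K \<subseteq> St s' \<longrightarrow> St s \<subseteq> K)"
    proof (rule exI[of _ s], rule exI[of _ s'], intro conjI allI impI)
      show "St s' \<subseteq> K" if "K \<lhd> G" "St k \<subseteq> K" "finite (rcosets K)" "card (rcosets K) \<le> n" for K k
        using small[OF that] .
      show "St s \<subseteq> K" if "K \<lhd> G" "St k \<subseteq> K" "\<not> K \<subseteq> St s'" for K k
        using big[OF that] .
    qed (rule ss, rule germs)
  qed
qed

end

section \<open>Paths and descendants in rooted trees\<close>

lemma is_path_Cons_Cons:
  "is_path T (x # y # p) \<longleftrightarrow> x \<in> verts T \<and> x \<notin> set (y # p) \<and> (x, y) \<in> edges T \<and> is_path T (y # p)"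
  by (auto simp: is_path_def)

lemma successively_snocI:
  "\<lbrakk>successively P (xs @ [c]); successively P (c # ys)\<rbrakk> \<Longrightarrow> successively P (xs @ c # ys)"
  by (simp add: successively_append_iff)

lemma is_path_prefix:
  assumes "is_path T (p @ q)" "p \<noteq> []"
  shows "is_path T p"
  using assms by (auto simp: is_path_def successively_append_iff)

text \<open>Two paths that part after their first vertex \<open>x\<close> and meet again give a cycle: go along the first
  path to the first vertex \<open>c\<close> that lies on the second, and back along the second to \<open>x\<close>.\<close>
lemma path_unique:
  assumes sym: "sym (edges T)" and acyclic: "\<nexists>c. is_cycle T c"
    and "is_path T p" "is_path T q" "hd p = hd q" "last p = last q"
  shows "p = q"
  using assms(3-)
proof (induction p arbitrary: q)
  case Nil
  then show ?case by (simp add: is_path_def)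
next
  case (Cons x p)
  obtain q' where q: "q = x # q'" using Cons.prems by (cases q) (auto simp: is_path_def)
  show ?case
  proof (cases "p = [] \<or> q' = []")
    case True
    have "distinct (x # p)" "distinct (x # q')" using Cons.prems q by (simp_all add: is_path_def)
    then show ?thesis using True Cons.prems(4) q last_in_set[of p] last_in_set[of q']
      by (auto split: if_splits)
  next
    case False
    then obtain y p1 z q1 where p: "p = y # p1" and q': "q' = z # q1"
      by (metis list.exhaust)
    have P: "is_path T p" "(x, y) \<in> edges T" "x \<notin> set p" "x \<in> verts T"
      using Cons.prems(1) p by (auto simp: is_path_Cons_Cons)
    have Q: "is_path T q'" "(x, z) \<in> edges T" "x \<notin> set q'"
      using Cons.prems(2) q q' by (auto simp: is_path_Cons_Cons)
    have l: "last p = last q'" using Cons.prems(4) q False by simp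
    show ?thesis
    proof (cases "y = z")
      case True
      then have "p = q'" using Cons.IH[OF P(1) Q(1) _ l] p q' by simp
      then show ?thesis using q by simp
    next
      case yz: False
      have "\<exists>c\<in>set p. c \<in> set q'" using last_in_set[of p] last_in_set[of q'] l False by force
      then obtain a c b where abc: "p = a @ c # b" "c \<in> set q'" "\<forall>u\<in>set a. u \<notin> set q'"
        using split_list_first_prop[of p "\<lambda>u. u \<in> set q'"] by blast
      obtain d e where de: "q' = d @ c # e" using abc(2) by (auto dest: split_list)
      let ?c = "x # a @ c # rev d"
      have dis: "distinct ?c" using P Q abc de by (auto simp: is_path_def)
      have vs: "set ?c \<subseteq> verts T" using P Q abc de by (auto simp: is_path_def)
      have sa: "successively (\<lambda>x y. (x, y) \<in> edges T) (x # a @ [c])"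
        using is_path_prefix[of T "x # a @ [c]" b] Cons.prems(1) abc(1) by (simp add: is_path_def)
      have "successively (\<lambda>x y. (x, y) \<in> edges T) (d @ [c])"
        using Q de unfolding is_path_def by (auto simp: successively_append_iff successively_Cons)
      then have "successively (\<lambda>y x. (x, y) \<in> edges T) (rev (d @ [c]))"
        by (simp only: successively_rev)
      then have sd: "successively (\<lambda>x y. (x, y) \<in> edges T) (c # rev d)"
        using sym by (auto simp: sym_conv_converse_eq converse_iff elim!: successively_mono dest: symD)
      have "successively (\<lambda>x y. (x, y) \<in> edges T) ((x # a) @ c # rev d)"
        using successively_snocI[of _ "x # a" c "rev d"] sa sd by simp
      then have path: "is_path T ?c" using dis vs by (simp add: is_path_def)
      have "a \<noteq> [] \<or> d \<noteq> []" using yz p q' abc(1) de by (cases a; cases d) auto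
      then have len: "3 \<le> length ?c" by (cases a; cases d) auto
      have "last ?c = z" using de q' by (cases d) auto
      then have "(last ?c, hd ?c) \<in> edges T" using Q(2) sym by (auto dest: symD)
      then have "is_cycle T ?c" using path len by (simp add: is_cycle_def)
      then show ?thesis using acyclic by blast
    qed
  qed
qed

lemma walk_imp_path:
  assumes sub: "edges T \<subseteq> verts T \<times> verts T" and x: "x \<in> verts T"
    and "(x, w) \<in> edges T ^^ n"
  shows "\<exists>p. is_path T p \<and> hd p = x \<and> last p = w \<and> length p \<le> Suc n"
  using assms(3)
proof (induction n arbitrary: w)
  case 0
  then show ?case using x by (intro exI[of _ "[x]"]) (simp add: is_path_def)
next
  case (Suc n)
  then obtain y where y: "(x, y) \<in> edges T ^^ n" "(y, w) \<in> edges T" by auto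
  then obtain p where p: "is_path T p" "hd p = x" "last p = y" "length p \<le> Suc n"
    using Suc.IH by blast
  have ne: "p \<noteq> []" using p(1) by (simp add: is_path_def)
  show ?case
  proof (cases "w \<in> set p")
    case True
    then obtain a b where ab: "p = a @ w # b" by (auto dest: split_list)
    then have "is_path T ((a @ [w]) @ b)" using p(1) by simp
    then have "is_path T (a @ [w])" by (rule is_path_prefix) simp
    moreover have "hd (a @ [w]) = x" using p(2) ab by (cases a) auto
    ultimately show ?thesis using p(4) ab by (intro exI[of _ "a @ [w]"]) simp
  next
    case False
    have "w \<in> verts T" using y sub by blast
    then have "is_path T (p @ [w])"
      using p False y ne by (auto simp: is_path_def successively_append_iff)
    then show ?thesis using p ne by (intro exI[of _ "p @ [w]"]) simp
  qed
qed

lemma successively_imp_walk: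
  "\<lbrakk>successively (\<lambda>x y. (x, y) \<in> E) p; p \<noteq> []\<rbrakk> \<Longrightarrow> (hd p, last p) \<in> E ^^ (length p - 1)"
proof (induction p)
  case (Cons x p)
  show ?case
  proof (cases p)
    case (Cons y q)
    then have "(y, last p) \<in> E ^^ (length p - 1)" "(x, y) \<in> E"
      using Cons.IH Cons.prems by auto
    then have "(x, last p) \<in> E ^^ Suc (length p - 1)" by (intro relpow_Suc_I2)
    then show ?thesis using Cons by simp
  qed simp
qed simp

text \<open>A rooted tree.  Norms and descendants are expressed by the unique path \<open>root_path u\<close> from the root to \<open>u\<close>,
  whose vertex number \<open>i\<close> is the ancestor of \<open>u\<close> of norm \<open>i\<close>.\<close>
locale rtree =
  fixes T :: "'a rgraph"
  assumes tree: "rooted_tree T"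
begin

lemma tree_facts:
  "edges T \<subseteq> verts T \<times> verts T" "sym (edges T)" "rt T \<in> verts T" "\<nexists>c. is_cycle T c"
  "x \<in> verts T \<Longrightarrow> finite {y. (x, y) \<in> edges T}"
  using tree unfolding rooted_tree_def by blast+

definition root_path :: "'a \<Rightarrow> 'a list" where
  "root_path u = (THE p. is_path T p \<and> hd p = rt T \<and> last p = u)"

lemma root_path_eqI:
  assumes "is_path T p" "hd p = rt T" "last p = u"
  shows "root_path u = p"
  unfolding root_path_def
proof (rule the_equality)
  fix q assume "is_path T q \<and> hd q = rt T \<and> last q = u"
  then show "q = p" using path_unique[OF tree_facts(2,4)] assms by simp
qed (use assms in simp)

lemma root_path:
  assumes "u \<in> verts T"
  shows "is_path T (root_path u)" "hd (root_path u) = rt T" "last (root_path u) = u"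
proof -
  obtain p where p: "is_path T p" "hd p = rt T" "last p = u"
    using tree assms tree_facts(3) unfolding rooted_tree_def by blast
  then show "is_path T (root_path u)" "hd (root_path u) = rt T" "last (root_path u) = u"
    using root_path_eqI[OF p] by simp_all
qed

lemma root_path_nonempty: "u \<in> verts T \<Longrightarrow> root_path u \<noteq> []"
  using root_path(1) by (auto simp: is_path_def)

lemma root_path_sub: "\<lbrakk>u \<in> verts T; w \<in> set (root_path u)\<rbrakk> \<Longrightarrow> w \<in> verts T"
  using root_path(1)[of u] unfolding is_path_def by blast

lemma length_root_path:
  assumes u: "u \<in> verts T"
  shows "length (root_path u) = Suc (vnorm T u)"
proof -
  have w: "(rt T, u) \<in> edges T ^^ (length (root_path u) - 1)"
    using successively_imp_walk[of "edges T" "root_path u"] root_path[OF u] by (simp add: is_path_def)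
  have "vnorm T u \<le> length (root_path u) - 1" unfolding vnorm_def by (rule Least_le) (rule w)
  moreover have "(rt T, u) \<in> edges T ^^ vnorm T u" unfolding vnorm_def by (rule LeastI) (rule w)
  from walk_imp_path[OF tree_facts(1,3) this]
  have "length (root_path u) \<le> Suc (vnorm T u)" using root_path_eqI by metis
  ultimately show ?thesis using root_path_nonempty[OF u] by (cases "root_path u") auto
qed

lemma root_path_prefix:
  assumes u: "u \<in> verts T" and i: "i \<le> vnorm T u"
  shows "root_path (root_path u ! i) = take (Suc i) (root_path u)" "vnorm T (root_path u ! i) = i" "root_path u ! i \<in> verts T"
proof -
  have l: "i < length (root_path u)" using length_root_path[OF u] i by simp
  show V: "root_path u ! i \<in> verts T" using root_path_sub[OF u] l by simp
  show 1: "root_path (root_path u ! i) = take (Suc i) (root_path u)"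
  proof (rule root_path_eqI)
    have "is_path T (take (Suc i) (root_path u) @ drop (Suc i) (root_path u))" using root_path(1)[OF u] by simp
    then show "is_path T (take (Suc i) (root_path u))" by (rule is_path_prefix) (use root_path_nonempty[OF u] in simp)
    show "hd (take (Suc i) (root_path u)) = rt T" using root_path(2)[OF u] by simp
    show "last (take (Suc i) (root_path u)) = root_path u ! i" using l by (simp add: take_Suc_conv_app_nth)
  qed
  show "vnorm T (root_path u ! i) = i" using length_root_path[OF V] 1 l by simp
qed

lemma descendants_iff: "w \<in> descendants T u \<longleftrightarrow> w \<in> verts T \<and> u \<in> set (root_path w)"
proof
  assume "w \<in> descendants T u"
  then obtain p where p: "is_path T p" "hd p = rt T" "last p = w" "u \<in> set p"
    by (auto simp: descendants_def)
  then have "w \<in> verts T" using last_in_set[of p] by (auto simp: is_path_def)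
  then show "w \<in> verts T \<and> u \<in> set (root_path w)" using root_path_eqI[OF p(1-3)] p(4) by simp
next
  assume "w \<in> verts T \<and> u \<in> set (root_path w)"
  then show "w \<in> descendants T u" unfolding descendants_def using root_path[of w] by blast
qed

lemma descendants_iff_nth:
  assumes w: "w \<in> verts T"
  shows "w \<in> descendants T u \<longleftrightarrow> vnorm T u \<le> vnorm T w \<and> root_path w ! vnorm T u = u"
proof
  assume "w \<in> descendants T u"
  then obtain i where i: "i < length (root_path w)" "u = root_path w ! i"
    unfolding descendants_iff in_set_conv_nth by auto
  then have "i \<le> vnorm T w" using length_root_path[OF w] by simp
  then show "vnorm T u \<le> vnorm T w \<and> root_path w ! vnorm T u = u"
    using root_path_prefix(2)[OF w] i by simp
next
  assume "vnorm T u \<le> vnorm T w \<and> root_path w ! vnorm T u = u"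
  then show "w \<in> descendants T u"
    unfolding descendants_iff using w length_root_path[OF w] nth_mem[of "vnorm T u" "root_path w"] by simp
qed

lemma descendants_sub: "descendants T u \<subseteq> verts T"
  using descendants_iff by blast

lemma descendants_self: "u \<in> verts T \<Longrightarrow> u \<in> descendants T u"
  using descendants_iff[of u u] root_path(3)[of u] last_in_set[OF root_path_nonempty[of u]] by simp

lemma descendants_root: "descendants T (rt T) = verts T"
  using descendants_iff[of _ "rt T"] root_path(2) hd_in_set[OF root_path_nonempty] by fastforce

lemma vnorm_root: "vnorm T (rt T) = 0"
proof -
  have "root_path (rt T) = [rt T]" using tree_facts(3) by (intro root_path_eqI) (simp_all add: is_path_def)
  then show ?thesis using length_root_path[OF tree_facts(3)] by simp
qed

lemma descendants_trans:
  assumes "u \<in> descendants T x" "w \<in> descendants T u"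
  shows "w \<in> descendants T x"
proof -
  have w: "w \<in> verts T" using assms(2) descendants_sub by blast
  have u: "vnorm T u \<le> vnorm T w" "root_path w ! vnorm T u = u"
    using assms(2) descendants_iff_nth[OF w] by simp_all
  have "root_path u = take (Suc (vnorm T u)) (root_path w)" using root_path_prefix(1)[OF w u(1)] u(2) by simp
  then have "x \<in> set (root_path w)" using assms(1) descendants_iff[of u x] set_take_subset by fastforce
  then show ?thesis using descendants_iff w by simp
qed

lemma finite_layer_tree: "finite (layer T k)"
proof (induction k)
  case 0
  have "u = rt T" if "u \<in> verts T" "vnorm T u = 0" for u
  proof -
    have "length (root_path u) = 1" using length_root_path[OF that(1)] that(2) by simp
    then show ?thesis using root_path[OF that(1)] by (cases "root_path u") auto
  qed
  then have "layer T 0 \<subseteq> {rt T}" by (auto simp: layer_def)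
  then show ?case by (rule finite_subset) simp
next
  case (Suc k)
  have "layer T (Suc k) \<subseteq> (\<Union>u\<in>layer T k. {y. (u, y) \<in> edges T})"
  proof
    fix w assume "w \<in> layer T (Suc k)"
    then have w: "w \<in> verts T" "vnorm T w = Suc k" by (simp_all add: layer_def)
    have l: "length (root_path w) = Suc (Suc k)" using length_root_path[OF w(1)] w(2) by simp
    have "(root_path w ! k, root_path w ! Suc k) \<in> edges T"
      using root_path(1)[OF w(1)] l by (auto simp: is_path_def successively_conv_nth)
    moreover have "root_path w ! Suc k = w" using root_path(3)[OF w(1)] l root_path_nonempty[OF w(1)] by (simp add: last_conv_nth)
    moreover have "root_path w ! k \<in> layer T k" using root_path_prefix[OF w(1), of k] w(2) by (simp add: layer_def)
    ultimately show "w \<in> (\<Union>u\<in>layer T k. {y. (u, y) \<in> edges T})" by auto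
  qed
  then show ?case
    by (rule finite_subset) (use Suc tree_facts(5) in \<open>auto simp: layer_def\<close>)
qed

lemma is_path_map:
  assumes "inj_on f (set p)" "f ` set p \<subseteq> verts T" "is_path T p"
    "\<And>x y. \<lbrakk>x \<in> set p; y \<in> set p; (x, y) \<in> edges T\<rbrakk> \<Longrightarrow> (f x, f y) \<in> edges T"
  shows "is_path T (map f p)"
  using assms unfolding is_path_def
  by (auto simp: distinct_map successively_map elim!: successively_mono)

lemma aut_root_path:
  assumes f: "f \<in> rooted_iso T T" and u: "u \<in> verts T"
  shows "root_path (f u) = map f (root_path u)"
proof (rule root_path_eqI)
  note F = f[unfolded rooted_iso_def bij_betw_def, simplified]
  have s: "set (root_path u) \<subseteq> verts T" using root_path_sub[OF u] by blast
  show "is_path T (map f (root_path u))"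
  proof (rule is_path_map[OF _ _ root_path(1)[OF u]])
    show "inj_on f (set (root_path u))" using F s by (blast intro: inj_on_subset)
    show "f ` set (root_path u) \<subseteq> verts T" using F s by blast
    show "(f x, f y) \<in> edges T" if "x \<in> set (root_path u)" "y \<in> set (root_path u)" "(x, y) \<in> edges T" for x y
      using F s that by blast
  qed
  show "hd (map f (root_path u)) = rt T" using root_path(2)[OF u] root_path_nonempty[OF u] F by (simp add: hd_map)
  show "last (map f (root_path u)) = f u" using root_path(3)[OF u] root_path_nonempty[OF u] by (simp add: last_map)
qed

lemma aut_V: "\<lbrakk>f \<in> rooted_iso T T; u \<in> verts T\<rbrakk> \<Longrightarrow> f u \<in> verts T"
  unfolding rooted_iso_def by (auto dest: bij_betwE)

lemma aut_vnorm: "\<lbrakk>f \<in> rooted_iso T T; u \<in> verts T\<rbrakk> \<Longrightarrow> vnorm T (f u) = vnorm T u"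
  using length_root_path[of u] length_root_path[of "f u"] aut_root_path[of f u] aut_V[of f u] by simp

lemma aut_descendants:
  "\<lbrakk>f \<in> rooted_iso T T; w \<in> descendants T u\<rbrakk> \<Longrightarrow> f w \<in> descendants T (f u)"
  using aut_root_path[of f w] aut_V[of f w] by (simp add: descendants_iff)

lemma iso_subtree_root_path:
  assumes f: "f \<in> rooted_iso T (subtree T v)" and v: "v \<in> verts T" and u: "u \<in> verts T"
  shows "root_path (f u) = root_path v @ map f (tl (root_path u))"
proof (rule root_path_eqI)
  have F: "inj_on f (verts T)" "f ` verts T = descendants T v" "f (rt T) = v"
    "\<And>x y. \<lbrakk>x \<in> verts T; y \<in> verts T; (x, y) \<in> edges T\<rbrakk> \<Longrightarrow> (f x, f y) \<in> edges T"
    using f by (auto simp: rooted_iso_def bij_betw_def subtree_def)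
  have s: "set (root_path u) \<subseteq> verts T" using root_path_sub[OF u] by blast
  obtain q where q: "root_path u = rt T # q" using root_path(2)[OF u] root_path_nonempty[OF u] by (cases "root_path u") auto
  have m: "is_path T (map f (root_path u))"
  proof (rule is_path_map[OF _ _ root_path(1)[OF u]])
    show "inj_on f (set (root_path u))" using F(1) s by (rule inj_on_subset)
    show "f ` set (root_path u) \<subseteq> verts T" using F(2) s descendants_sub[of v] by blast
    show "(f x, f y) \<in> edges T" if "x \<in> set (root_path u)" "y \<in> set (root_path u)" "(x, y) \<in> edges T" for x y
      using F(4) s that by blast
  qed
  have dis: "set (root_path v) \<inter> set (map f q) = {}"
  proof (rule ccontr)
    assume "\<not> ?thesis"
    then obtain x where x: "x \<in> set (root_path v)" "x \<in> f ` set q" by auto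
    have xV: "x \<in> descendants T v" using x(2) F(2) s q by auto
    have "v \<in> descendants T x" using x(1) v by (simp add: descendants_iff)
    then have "vnorm T x = vnorm T v" "root_path x ! vnorm T v = v" "root_path v ! vnorm T x = x"
      using xV v descendants_iff_nth[of x v] descendants_iff_nth[of v x] descendants_sub by force+
    moreover have "x \<in> verts T" using xV descendants_sub by blast
    moreover have "root_path x ! vnorm T x = x"
      using descendants_iff_nth[of x x] descendants_self[of x] \<open>x \<in> verts T\<close> by simp
    ultimately have "x = v" by simp
    moreover have "v \<notin> f ` set q" using m F(3) by (auto simp: q is_path_def)
    ultimately show False using x(2) by simp
  qed
  have ne: "root_path v \<noteq> []" using root_path_nonempty[OF v] .
  have tl: "tl (root_path u) = q" using q by simp
  have "successively (\<lambda>x y. (x, y) \<in> edges T) (v # map f q)" "distinct (map f q)"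
      "set (map f q) \<subseteq> verts T"
    using m F(3) unfolding q is_path_def by auto
  then show "is_path T (root_path v @ map f (tl (root_path u)))"
    using root_path(1)[OF v] root_path(3)[OF v] dis unfolding tl is_path_def
    by (cases q) (auto simp: successively_append_iff successively_Cons)
  show "hd (root_path v @ map f (tl (root_path u))) = rt T" using root_path(2)[OF v] ne by simp
  show "last (root_path v @ map f (tl (root_path u))) = f u"
  proof (cases "q = []")
    case True
    then have "u = rt T" using root_path(3)[OF u] q by simp
    then show ?thesis using True tl F(3) root_path(3)[OF v] by simp
  next
    case False
    then show ?thesis using root_path(3)[OF u] q tl by (simp add: last_map)
  qed
qed

lemma iso_subtree_vnorm:
  assumes f: "f \<in> rooted_iso T (subtree T v)" and v: "v \<in> verts T" and u: "u \<in> verts T"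
  shows "vnorm T (f u) = vnorm T v + vnorm T u"
proof -
  have "f u \<in> verts T"
    using f u descendants_sub[of v] by (auto simp: rooted_iso_def subtree_def dest: bij_betwE)
  then show ?thesis
    using iso_subtree_root_path[OF assms] length_root_path[of "f u"] length_root_path[OF v] length_root_path[OF u] by simp
qed

lemma iso_subtree_descendants:
  assumes f: "f \<in> rooted_iso T (subtree T v)" and v: "v \<in> verts T" and w: "w \<in> descendants T u"
  shows "f w \<in> descendants T (f u)"
proof -
  have wV: "w \<in> verts T" "u \<in> set (root_path w)" using w by (simp_all add: descendants_iff)
  have fw: "f w \<in> verts T"
    using f wV descendants_sub[of v] by (auto simp: rooted_iso_def subtree_def dest: bij_betwE)
  obtain q where q: "root_path w = rt T # q" using root_path(2)[OF wV(1)] root_path_nonempty[OF wV(1)] by (cases "root_path w") auto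
  have "f (rt T) = v" using f by (simp add: rooted_iso_def subtree_def)
  moreover have "v \<in> set (root_path v)" using last_in_set[OF root_path_nonempty[OF v]] root_path(3)[OF v] by simp
  ultimately have "f u \<in> set (root_path v @ map f q)" using wV(2) q by auto
  then show ?thesis using iso_subtree_root_path[OF f v wV(1)] q fw by (simp add: descendants_iff)
qed

end

section \<open>The automorphism group and its topology\<close>

context rtree
begin

lemma rooted_iso_self:
  "f \<in> rooted_iso T T \<longleftrightarrow> bij_betw f (verts T) (verts T) \<and> f (rt T) = rt T \<and>
     (\<forall>x\<in>verts T. \<forall>y\<in>verts T. (f x, f y) \<in> edges T \<longleftrightarrow> (x, y) \<in> edges T)"
  by (simp add: rooted_iso_def)

lemma carrier_tree_aut: "carrier (tree_aut T) = Bij (verts T) \<inter> rooted_iso T T"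
  by (simp add: tree_aut_def)

lemma group_tree_aut: "group (tree_aut T)"
proof -
  have "subgroup (Bij (verts T) \<inter> rooted_iso T T) (BijGroup (verts T))"
  proof (rule group.subgroupI[OF group_BijGroup])
    show "Bij (verts T) \<inter> rooted_iso T T \<subseteq> carrier (BijGroup (verts T))"
      by (simp add: BijGroup_def)
    have "(\<lambda>x\<in>verts T. x) \<in> rooted_iso T T"
      using id_Bij[of "verts T"] tree_facts(3) unfolding rooted_iso_self Bij_def by simp
    then show "Bij (verts T) \<inter> rooted_iso T T \<noteq> {}" using id_Bij[of "verts T"] by blast
  next
    fix f assume f: "f \<in> Bij (verts T) \<inter> rooted_iso T T"
    then have F: "bij_betw f (verts T) (verts T)" "f (rt T) = rt T"
      "\<And>x y. \<lbrakk>x \<in> verts T; y \<in> verts T\<rbrakk> \<Longrightarrow> (f x, f y) \<in> edges T \<longleftrightarrow> (x, y) \<in> edges T"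
      by (simp_all add: rooted_iso_self)
    let ?h = "\<lambda>x\<in>verts T. inv_into (verts T) f x"
    have h: "?h \<in> Bij (verts T)" using f restrict_inv_into_Bij by blast
    have "?h (rt T) = rt T"
      using inv_into_f_f[OF bij_betw_imp_inj_on[OF F(1)] tree_facts(3)] F(2) tree_facts(3) by simp
    moreover have "(?h x, ?h y) \<in> edges T \<longleftrightarrow> (x, y) \<in> edges T"
      if "x \<in> verts T" "y \<in> verts T" for x y
    proof -
      have "?h x \<in> verts T" "?h y \<in> verts T" "f (?h x) = x" "f (?h y) = y"
        using that F(1) by (simp_all add: bij_betw_def f_inv_into_f inv_into_into)
      then show ?thesis using F(3)[of "?h x" "?h y"] by simp
    qed
    ultimately have "?h \<in> rooted_iso T T" using h unfolding rooted_iso_self Bij_def by blast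
    moreover have "inv\<^bsub>BijGroup (verts T)\<^esub> f = ?h" using f by (intro inv_BijGroup) blast
    ultimately show "inv\<^bsub>BijGroup (verts T)\<^esub> f \<in> Bij (verts T) \<inter> rooted_iso T T"
      using h by simp
  next
    fix f g assume f: "f \<in> Bij (verts T) \<inter> rooted_iso T T" and g: "g \<in> Bij (verts T) \<inter> rooted_iso T T"
    have m: "f \<otimes>\<^bsub>BijGroup (verts T)\<^esub> g = compose (verts T) f g"
      using f g by (simp add: BijGroup_def)
    have B: "compose (verts T) f g \<in> Bij (verts T)" using compose_Bij f g by blast
    moreover have "compose (verts T) f g \<in> rooted_iso T T"
    proof -
      have "bij_betw (compose (verts T) f g) (verts T) (verts T)" using B by (simp add: Bij_def)
      then show ?thesis
        using f g aut_V[of g] tree_facts(3) unfolding rooted_iso_self by (simp add: rooted_iso_self compose_eq)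
    qed
    ultimately show "f \<otimes>\<^bsub>BijGroup (verts T)\<^esub> g \<in> Bij (verts T) \<inter> rooted_iso T T"
      using m by simp
  qed
  from group.subgroup_imp_group[OF group_BijGroup this] show ?thesis by (simp add: tree_aut_def)
qed

lemma tree_aut_mult:
  "\<lbrakk>g \<in> carrier (tree_aut T); h \<in> carrier (tree_aut T); u \<in> verts T\<rbrakk>
     \<Longrightarrow> (g \<otimes>\<^bsub>tree_aut T\<^esub> h) u = g (h u)"
  by (simp add: tree_aut_def BijGroup_def compose_def)

lemma tree_aut_one: "u \<in> verts T \<Longrightarrow> \<one>\<^bsub>tree_aut T\<^esub> u = u"
  by (simp add: tree_aut_def BijGroup_def)

lemma tree_aut_ext:
  "\<lbrakk>g \<in> carrier (tree_aut T); h \<in> carrier (tree_aut T); \<And>u. u \<in> verts T \<Longrightarrow> g u = h u\<rbrakk> \<Longrightarrow> g = h"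
  by (auto simp: carrier_tree_aut Bij_def intro: extensionalityI)

lemma tree_aut_iso: "g \<in> carrier (tree_aut T) \<Longrightarrow> g \<in> rooted_iso T T"
  by (simp add: carrier_tree_aut)

lemma tree_aut_inv:
  assumes "g \<in> carrier (tree_aut T)" "u \<in> verts T"
  shows "(inv\<^bsub>tree_aut T\<^esub> g) (g u) = u"
proof -
  have i: "inv\<^bsub>tree_aut T\<^esub> g \<in> carrier (tree_aut T)"
    using group.inv_closed[OF group_tree_aut assms(1)] .
  have "(inv\<^bsub>tree_aut T\<^esub> g \<otimes>\<^bsub>tree_aut T\<^esub> g) u = u"
    using group.l_inv[OF group_tree_aut assms(1)] tree_aut_one[OF assms(2)] by simp
  then show ?thesis using tree_aut_mult[OF i assms] by simp
qed

text \<open>Agreement on all vertices of norm at most \<open>k\<close>, that is, equality modulo \<open>level_stab T k\<close>.\<close>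
definition agree :: "nat \<Rightarrow> ('a \<Rightarrow> 'a) \<Rightarrow> ('a \<Rightarrow> 'a) \<Rightarrow> bool" where
  "agree k g h \<longleftrightarrow> (\<forall>u\<in>verts T. vnorm T u \<le> k \<longrightarrow> g u = h u)"

lemma coset_agree:
  assumes x: "x \<in> carrier (tree_aut T)"
  shows "x <#\<^bsub>tree_aut T\<^esub> level_stab T k = {y \<in> carrier (tree_aut T). agree k y x}"
    (is "?L = ?R")
proof
  interpret A: group "tree_aut T" by (rule group_tree_aut)
  show "?L \<subseteq> ?R"
  proof
    fix y assume "y \<in> ?L"
    then obtain s where s: "s \<in> level_stab T k" "y = x \<otimes>\<^bsub>tree_aut T\<^esub> s"
      by (auto simp: l_coset_def)
    then show "y \<in> ?R"
      using x tree_aut_mult[OF x] by (auto simp: level_stab_def agree_def)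
  qed
  show "?R \<subseteq> ?L"
  proof
    fix y assume y: "y \<in> ?R"
    define s where "s = inv\<^bsub>tree_aut T\<^esub> x \<otimes>\<^bsub>tree_aut T\<^esub> y"
    have yc: "y \<in> carrier (tree_aut T)" using y by simp
    have ic: "inv\<^bsub>tree_aut T\<^esub> x \<in> carrier (tree_aut T)" using A.inv_closed[OF x] .
    have "s u = u" if "u \<in> verts T" "vnorm T u \<le> k" for u
      using that y tree_aut_mult[OF ic yc that(1)] tree_aut_inv[OF x that(1)]
      by (simp add: s_def agree_def)
    then have "s \<in> level_stab T k" using A.m_closed[OF ic yc] by (simp add: level_stab_def s_def)
    moreover have "y = x \<otimes>\<^bsub>tree_aut T\<^esub> s"
      using x yc by (simp add: s_def A.m_assoc[symmetric])
    ultimately show "y \<in> ?L" by (auto simp: l_coset_def)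
  qed
qed

lemma agree_trans: "\<lbrakk>agree k x y; agree k y z\<rbrakk> \<Longrightarrow> agree k x z"
  and agree_sym: "agree k x y \<Longrightarrow> agree k y x"
  and agree_refl: "agree k x x"
  and agree_mono: "\<lbrakk>agree l x y; k \<le> l\<rbrakk> \<Longrightarrow> agree k x y"
  by (auto simp: agree_def)

lemma openin_agree: "x \<in> carrier (tree_aut T) \<Longrightarrow>
    openin (aut_topology T) {y \<in> carrier (tree_aut T). agree k y x}"
  unfolding aut_topology_def coset_agree[symmetric]
  by (rule topology_generated_by_Basis) blast

lemma open_contains_agree:
  assumes "openin (aut_topology T) U" "x \<in> U" "x \<in> carrier (tree_aut T)"
  shows "\<exists>k. \<forall>y\<in>carrier (tree_aut T). agree k y x \<longrightarrow> y \<in> U"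
proof -
  have "generate_topology_on {g <#\<^bsub>tree_aut T\<^esub> level_stab T n | g n. g \<in> carrier (tree_aut T)} U"
    using assms(1) unfolding aut_topology_def by (rule openin_topology_generated_by)
  then show ?thesis using assms(2)
  proof induction
    case (Int a b)
    then obtain k l where
      "\<forall>y\<in>carrier (tree_aut T). agree k y x \<longrightarrow> y \<in> a"
      "\<forall>y\<in>carrier (tree_aut T). agree l y x \<longrightarrow> y \<in> b" by blast
    then have "\<forall>y\<in>carrier (tree_aut T). agree (max k l) y x \<longrightarrow> y \<in> a \<inter> b"
      using agree_mono[of "max k l" _ x] by simp
    then show ?case by blast
  next
    case (UN K)
    then show ?case by blast
  next
    case (Basis s)
    then obtain g k where g: "g \<in> carrier (tree_aut T)" "s = {y \<in> carrier (tree_aut T). agree k y g}"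
      using coset_agree by blast
    then have "\<forall>y\<in>carrier (tree_aut T). agree k y x \<longrightarrow> y \<in> s"
      using Basis.prems agree_trans[of k _ x g] by simp
    then show ?case by blast
  qed simp
qed

end

text \<open>A closed, spherically transitive group of tree automorphisms.\<close>
locale tree_action = rtree +
  fixes G :: "('a \<Rightarrow> 'a) set"
  assumes closed: "closed_subgroup T G" and transitive: "spherically_transitive T G"
begin

lemma G_subgroup: "subgroup G (tree_aut T)" and G_closedin: "closedin (aut_topology T) G"
  using closed by (simp_all add: closed_subgroup_def)

lemma G_sub: "g \<in> G \<Longrightarrow> g \<in> carrier (tree_aut T)"
  using subgroup.subset[OF G_subgroup] by blast

lemma carrier_aut_group [simp]: "carrier (aut_group T G) = G"
  and mult_aut_group: "mult (aut_group T G) = mult (tree_aut T)"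
  and one_aut_group: "one (aut_group T G) = one (tree_aut T)"
  by (simp_all add: aut_group_def)

lemma group_aut_group: "group (aut_group T G)"
  unfolding aut_group_def by (rule group.subgroup_imp_group[OF group_tree_aut G_subgroup])

sublocale level_action "aut_group T G" "verts T" "vnorm T" "descendants T" "rt T"
proof (rule level_action.intro[OF group_aut_group], unfold_locales, unfold carrier_aut_group mult_aut_group one_aut_group)
  fix g h u w x u' and k :: nat
  show "g = h" if "g \<in> G" "h \<in> G" "\<And>u. u \<in> verts T \<Longrightarrow> g u = h u"
    using tree_aut_ext[OF G_sub[OF that(1)] G_sub[OF that(2)] that(3)] .
  show "(g \<otimes>\<^bsub>tree_aut T\<^esub> h) u = g (h u)" if "g \<in> G" "h \<in> G" "u \<in> verts T"
    using tree_aut_mult[OF G_sub[OF that(1)] G_sub[OF that(2)] that(3)] .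
  show "\<one>\<^bsub>tree_aut T\<^esub> u = u" if "u \<in> verts T" using tree_aut_one[OF that] .
  show "g u \<in> verts T" if "g \<in> G" "u \<in> verts T"
    using aut_V[OF tree_aut_iso[OF G_sub[OF that(1)]] that(2)] .
  show "vnorm T (g u) = vnorm T u" if "g \<in> G" "u \<in> verts T"
    using aut_vnorm[OF tree_aut_iso[OF G_sub[OF that(1)]] that(2)] .
  show "g w \<in> descendants T (g u)" if "g \<in> G" "u \<in> verts T" "w \<in> descendants T u"
    using aut_descendants[OF tree_aut_iso[OF G_sub[OF that(1)]] that(3)] .
  show "\<exists>g\<in>G. g u = w" if "u \<in> verts T" "w \<in> verts T" "vnorm T u = vnorm T w"
    using transitive that unfolding spherically_transitive_def layer_def by simp
  show "descendants T u \<subseteq> verts T" by (rule descendants_sub)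
  show "u \<in> descendants T u" if "u \<in> verts T" using descendants_self[OF that] .
  show "w \<in> descendants T x" if "x \<in> verts T" "u \<in> descendants T x" "w \<in> descendants T u"
    using descendants_trans[OF that(2,3)] .
  show "vnorm T u \<le> vnorm T w" if "u \<in> verts T" "w \<in> descendants T u"
    using that(2) descendants_iff_nth[of w u] descendants_sub[of u] by blast
  show "u = u'" if "u \<in> verts T" "u' \<in> verts T" "w \<in> descendants T u" "w \<in> descendants T u'"
      "vnorm T u = vnorm T u'"
  proof -
    have "w \<in> verts T" using that(3) descendants_sub by blast
    then show ?thesis
      using that(3-5) descendants_iff_nth[of w u] descendants_iff_nth[of w u'] by simp
  qed
  show "\<exists>u\<in>verts T. vnorm T u = k \<and> w \<in> descendants T u" if "w \<in> verts T" "k \<le> vnorm T w"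
    using root_path_prefix(2,3)[OF that] descendants_iff_nth[OF that(1), of "root_path w ! k"] that(2)
    by (intro bexI[of _ "root_path w ! k"]) simp_all
  show "rt T \<in> verts T" by (rule tree_facts)
  show "descendants T (rt T) = verts T" by (rule descendants_root)
  show "vnorm T (rt T) = 0" by (rule vnorm_root)
  show "finite {u \<in> verts T. vnorm T u = k}" using finite_layer_tree[of k] by (simp add: layer_def)
qed

text \<open>No automorphism property of \<open>h\<close> is assumed: being an automorphism can be checked on balls, where
  \<open>h\<close> agrees with elements of \<open>G\<close>.\<close>
lemma approximable_mem:
  assumes ext: "h \<in> extensional (verts T)" and ap: "\<And>k. \<exists>g\<in>G. agree k h g"
  shows "h \<in> G"
proof -
  have ap2: "\<exists>g\<in>G. h u = g u \<and> h w = g w" if "u \<in> verts T" "w \<in> verts T" for u w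
    using ap[of "max (vnorm T u) (vnorm T w)"] that unfolding agree_def by fastforce
  have hV: "h u \<in> verts T \<and> vnorm T (h u) = vnorm T u" if u: "u \<in> verts T" for u
  proof -
    from ap2[OF u u] obtain g where "g \<in> G" "h u = g u \<and> h u = g u" ..
    then show ?thesis using u lev_act[of g u] act_closed[of g u] by simp
  qed
  have inj: "inj_on h (verts T)"
  proof (rule inj_onI)
    fix u w assume uw: "u \<in> verts T" "w \<in> verts T" "h u = h w"
    from ap2[OF uw(1,2)] obtain g where g: "g \<in> G" "h u = g u \<and> h w = g w" ..
    have "g u = g w" using g(2) uw(3) by metis
    then show "u = w" using act_eq_iff[of g u w] g(1) uw(1,2) by simp
  qed
  have "verts T \<subseteq> h ` verts T"
  proof
    fix w assume w: "w \<in> verts T"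
    obtain g where g: "g \<in> G" "agree (vnorm T w) h g" using ap by blast
    define u where "u = (inv\<^bsub>aut_group T G\<^esub> g) w"
    have gi: "inv\<^bsub>aut_group T G\<^esub> g \<in> G" using inv_closed[of g] g(1) by simp
    have u: "u \<in> verts T" "g u = w" "vnorm T u = vnorm T w"
      using g(1) gi w act_inv[of g w] by (simp_all add: u_def)
    then have "h u = w" using g(2) by (simp add: agree_def)
    then show "w \<in> h ` verts T" using u(1) by blast
  qed
  then have bij: "bij_betw h (verts T) (verts T)" using inj hV by (auto simp: bij_betw_def)
  have "h (rt T) = rt T" using ap2[of "rt T" "rt T"] tree_aut_iso[OF G_sub] tree_facts(3)
    by (auto simp: rooted_iso_self)
  moreover have "(h x, h y) \<in> edges T \<longleftrightarrow> (x, y) \<in> edges T" if xy: "x \<in> verts T" "y \<in> verts T" for x y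
  proof -
    from ap2[OF xy] obtain g where g: "g \<in> G" "h x = g x \<and> h y = g y" ..
    then show ?thesis using tree_aut_iso[OF G_sub[OF g(1)]] xy by (simp add: rooted_iso_self)
  qed
  ultimately have hc: "h \<in> carrier (tree_aut T)"
    using bij ext by (simp add: carrier_tree_aut rooted_iso_self Bij_def)
  show ?thesis
  proof (rule ccontr)
    assume nh: "h \<notin> G"
    have "h \<in> topspace (aut_topology T)"
      using openin_subset[OF openin_agree[OF hc, of 0]] hc agree_refl by blast
    then have "h \<in> topspace (aut_topology T) - G" using nh by blast
    moreover have "openin (aut_topology T) (topspace (aut_topology T) - G)"
      using G_closedin by (simp add: closedin_def)
    ultimately obtain k where k: "\<forall>y\<in>carrier (tree_aut T). agree k y h \<longrightarrow> y \<in> topspace (aut_topology T) - G"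
      using open_contains_agree hc by blast
    obtain g where "g \<in> G" "agree k h g" using ap by blast
    then show False using k G_sub agree_sym by blast
  qed
qed

lemma topspace_sub_topology: "topspace (sub_topology T G) = G"
proof -
  have "G \<subseteq> topspace (aut_topology T)" using G_closedin by (simp add: closedin_def)
  then show ?thesis by (auto simp: sub_topology_def)
qed

lemma lev_closed_imp_closedin:
  assumes C: "lev_closed C"
  shows "closedin (sub_topology T G) C"
proof -
  have CG: "C \<subseteq> G" using C by (simp add: lev_closed_def)
  have "\<exists>k. \<forall>c\<in>C. \<not> agree k c x" if x: "x \<in> G - C" for x
    using C x unfolding lev_closed_def agree_def carrier_aut_group by (meson DiffD1 DiffD2)
  then obtain k where k: "\<And>x. x \<in> G - C \<Longrightarrow> \<forall>c\<in>C. \<not> agree (k x) c x" by metis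
  define U where "U = (\<Union>x\<in>G - C. {y \<in> carrier (tree_aut T). agree (k x) y x})"
  have "openin (aut_topology T) U"
    unfolding U_def using openin_agree G_sub by (intro openin_Union) auto
  moreover have "G - C = U \<inter> G"
  proof
    show "G - C \<subseteq> U \<inter> G" using G_sub agree_refl by (auto simp: U_def)
    show "U \<inter> G \<subseteq> G - C" using k by (auto simp: U_def)
  qed
  ultimately have "openin (sub_topology T G) (G - C)"
    unfolding sub_topology_def openin_subtopology by blast
  then show ?thesis using CG by (simp add: closedin_def topspace_sub_topology)
qed

lemma openin_imp_contains_St:
  assumes K: "subgroup K (aut_group T G)" and op: "openin (sub_topology T G) K"
  shows "\<exists>k. St k \<subseteq> K"
proof -
  obtain U where U: "openin (aut_topology T) U" "K = U \<inter> G"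
    using op by (auto simp: sub_topology_def openin_subtopology)
  let ?e = "\<one>\<^bsub>tree_aut T\<^esub>"
  have e: "?e \<in> U" "?e \<in> carrier (tree_aut T)"
    using subgroup.one_closed[OF K] U(2) G_sub by (auto simp: one_aut_group)
  obtain k where k: "\<forall>y\<in>carrier (tree_aut T). agree k y ?e \<longrightarrow> y \<in> U"
    using open_contains_agree[OF U(1) e] by blast
  have "y \<in> K" if y: "y \<in> St k" for y
  proof -
    have "y \<in> G" using St_carrier[OF y] by simp
    moreover have "agree k y ?e" using St_fix[OF y] tree_aut_one by (simp add: agree_def)
    ultimately show ?thesis using k G_sub U(2) by blast
  qed
  then show ?thesis by blast
qed

lemma restrict_Bij:
  assumes g: "g \<in> G" and u: "u \<in> verts T" "g u = u"
  shows "restrict g (descendants T u) \<in> Bij (descendants T u)"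
proof -
  have "inj_on g (descendants T u)"
  proof (rule inj_onI)
    fix x y assume xy: "x \<in> descendants T u" "y \<in> descendants T u" "g x = g y"
    then have "x \<in> verts T" "y \<in> verts T" using descendants_sub by blast+
    then show "x = y" using act_eq_iff[of g x y] g xy(3) by simp
  qed
  moreover have "g ` descendants T u = descendants T u"
  proof
    show "g ` descendants T u \<subseteq> descendants T u"
      using D_act[of g u] g u by auto
    show "descendants T u \<subseteq> g ` descendants T u"
    proof
      fix w assume w: "w \<in> descendants T u"
      have wV: "w \<in> verts T" using w descendants_sub by blast
      let ?z = "(inv\<^bsub>aut_group T G\<^esub> g) w"
      have gi: "inv\<^bsub>aut_group T G\<^esub> g \<in> G" using inv_closed[of g] g by simp
      have z: "?z \<in> verts T" "g ?z = w" using g gi wV act_inv[of g w] act_closed[of _ w] by simp_all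
      then have "?z \<in> descendants T u" using D_act_iff[of g u ?z] g u w by simp
      then show "w \<in> g ` descendants T u" using z(2) by (metis imageI)
    qed
  qed
  ultimately show ?thesis by (simp add: Bij_def bij_betw_def)
qed

text \<open>Finite index of the product of the groups \<open>L_set T G w\<close> over the layer of \<open>v\<close> gives finite index for
  the single factor at \<open>v\<close>, here transported to \<open>G\<close> by \<open>f\<close>.\<close>
lemma branch_cover:
  assumes f: "f \<in> rooted_iso T (subtree T v)" and v: "v \<in> verts T"
    and conj: "\<And>x. x \<in> G \<Longrightarrow>
      restrict (f \<circ> x \<circ> inv_into (verts T) f) (descendants T v) \<in> U_set T G v"
    and fin: "group_index (U_layer T G (vnorm T v)) (L_layer T G (vnorm T v)) < \<infinity>"
  shows "\<exists>F. finite F \<and> F \<subseteq> G \<and> (\<forall>x\<in>G. \<exists>y\<in>F. \<exists>g\<in>G.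
     (\<forall>u\<in>verts T. g (f u) = f ((x \<otimes>\<^bsub>aut_group T G\<^esub> inv\<^bsub>aut_group T G\<^esub> y) u)) \<and>
     (\<forall>w\<in>verts T - descendants T v. g w = w))"
proof -
  let ?m = "vnorm T v" and ?D = "descendants T"
  have finj: "inj_on f (verts T)" and fD: "\<And>u. u \<in> verts T \<Longrightarrow> f u \<in> ?D v"
    using f by (auto simp: rooted_iso_def subtree_def bij_betw_def)
  define cj where "cj = (\<lambda>x. restrict (f \<circ> x \<circ> inv_into (verts T) f) (?D v))"
  have cj: "cj x (f u) = f (x u)" if "u \<in> verts T" for x u
    using that fD inv_into_f_f[OF finj] by (simp add: cj_def)
  let ?e = "\<one>\<^bsub>tree_aut T\<^esub>"
  have eG: "?e \<in> G" using one_closed by (simp add: one_aut_group)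
  \<comment> \<open>The element of the product with the copy of \<open>x\<close> in the factor at \<open>v\<close> and \<open>1\<close> in the others.\<close>
  define \<theta> where "\<theta> = (\<lambda>x. \<lambda>w\<in>layer T ?m. if w = v then cj x else restrict ?e (?D w))"
  have U_mult: "(a \<otimes>\<^bsub>U_group T G w\<^esub> b) = compose (?D w) a b"
    if "a \<in> U_set T G w" "b \<in> U_set T G w" "w \<in> verts T" for a b w
  proof -
    have "a \<in> Bij (?D w)" "b \<in> Bij (?D w)" using that restrict_Bij by (auto simp: U_set_def)
    then show ?thesis
      by (simp add: U_group_def aut_group_def tree_aut_def BijGroup_def subtree_def)
  qed
  have eU: "restrict ?e (?D w) \<in> U_set T G w" if "w \<in> verts T" for w
    using eG tree_aut_one[OF that] by (auto simp: U_set_def)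
  have \<theta>U: "\<theta> x w \<in> U_set T G w" if "x \<in> G" "w \<in> layer T ?m" for x w
    using that conj[OF that(1)] eU by (auto simp: \<theta>_def cj_def layer_def)
  have \<theta>c: "\<theta> x \<in> carrier (U_layer T G ?m)" if "x \<in> G" for x
    using \<theta>U[OF that] by (simp add: U_layer_def U_group_def aut_group_def \<theta>_def PiE_iff)
  define c where "c = (\<lambda>x. L_layer T G ?m #>\<^bsub>U_layer T G ?m\<^esub> \<theta> x)"
  have "finite (rcosets\<^bsub>U_layer T G ?m\<^esub> L_layer T G ?m)"
    using fin by (auto simp: group_index_def split: if_splits)
  moreover have "c ` G \<subseteq> rcosets\<^bsub>U_layer T G ?m\<^esub> L_layer T G ?m"
    using \<theta>c by (auto simp: c_def RCOSETS_def)
  ultimately have "finite (c ` G)" by (rule rev_finite_subset)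
  from finite_subset_image[OF this subset_refl]
  obtain F where F: "F \<subseteq> G" "finite F" "c ` G = c ` F" by metis
  have "\<exists>y\<in>F. \<exists>g\<in>G.
     (\<forall>u\<in>verts T. g (f u) = f ((x \<otimes>\<^bsub>aut_group T G\<^esub> inv\<^bsub>aut_group T G\<^esub> y) u)) \<and>
     (\<forall>w\<in>verts T - ?D v. g w = w)" if x: "x \<in> G" for x
  proof -
    have "c x \<in> c ` F" unfolding F(3)[symmetric] using x by (rule imageI)
    then obtain y where y: "y \<in> F" "c x = c y" by (rule imageE)
    have yG: "y \<in> G" using y F by blast
    \<comment> \<open>The coset of \<open>\<theta> x\<close> contains \<open>\<theta> x\<close> because it contains the product of \<open>\<theta> x\<close> with the identity \<open>?I\<close>.\<close>
    let ?I = "\<lambda>w\<in>layer T ?m. restrict ?e (?D w)"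
    have eL: "?e \<in> L_set T G w" if "w \<in> verts T" for w
      using eG that tree_aut_one by (simp add: L_set_def)
    have IL: "?I \<in> L_layer T G ?m" using eL by (auto simp: L_layer_def layer_def)
    have "?I \<otimes>\<^bsub>U_layer T G ?m\<^esub> \<theta> x = \<theta> x"
    proof -
      have 1: "restrict ?e (?D w) \<otimes>\<^bsub>U_group T G w\<^esub> \<theta> x w = \<theta> x w" if w: "w \<in> layer T ?m" for w
      proof -
        have wV: "w \<in> verts T" using w by (simp add: layer_def)
        obtain h where h: "h \<in> G" "h w = w" "\<theta> x w = restrict h (?D w)"
          using \<theta>U[OF x w] by (auto simp: U_set_def)
        have "compose (?D w) (restrict ?e (?D w)) (restrict h (?D w)) = restrict h (?D w)"
        proof (rule ext)
          fix u
          have "h u \<in> ?D w \<and> h u \<in> verts T" if "u \<in> ?D w"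
            using D_act[of h w u] h wV that descendants_sub by auto
          then show "compose (?D w) (restrict ?e (?D w)) (restrict h (?D w)) u = restrict h (?D w) u"
            by (simp add: compose_def tree_aut_one)
        qed
        then show ?thesis using U_mult[OF eU[OF wV] \<theta>U[OF x w] wV] h(3) by simp
      qed
      have "?I \<otimes>\<^bsub>U_layer T G ?m\<^esub> \<theta> x = (\<lambda>w\<in>layer T ?m. \<theta> x w)"
        unfolding U_layer_def mult_product_group by (rule restrict_ext) (simp add: 1)
      also have "\<dots> = \<theta> x" unfolding \<theta>_def by (rule extensional_restrict) (rule restrict_extensional)
      finally show ?thesis .
    qed
    then have "\<theta> x \<in> c x" using IL unfolding c_def r_coset_def by blast
    then obtain l where l: "l \<in> L_layer T G ?m" "\<theta> x = l \<otimes>\<^bsub>U_layer T G ?m\<^esub> \<theta> y"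
      unfolding y(2) unfolding c_def r_coset_def by blast
    have vm: "v \<in> layer T ?m" using v by (simp add: layer_def)
    obtain g where g: "g \<in> L_set T G v" "l v = restrict g (?D v)"
      using l(1) vm by (auto simp: L_layer_def PiE_iff)
    have gG: "g \<in> G" "g v = v" "\<forall>w\<in>verts T - ?D v. g w = w"
      using g(1) by (auto simp: L_set_def)
    have "l v \<in> U_set T G v" using g(2) gG by (auto simp: U_set_def)
    then have "\<theta> x v = compose (?D v) (l v) (\<theta> y v)"
      using l(2) vm U_mult[OF _ \<theta>U[OF yG vm] v] by (simp add: U_layer_def)
    then have cjx: "cj x = compose (?D v) (restrict g (?D v)) (cj y)"
      using vm g(2) by (simp add: \<theta>_def)
    have key: "f (x u) = g (f (y u))" if u: "u \<in> verts T" for u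
    proof -
      have "y u \<in> verts T" using act_closed[of y u] yG u by simp
      then show ?thesis
        using fun_cong[OF cjx, of "f u"] cj[OF u] fD u by (simp add: compose_def)
    qed
    have "g (f u) = f ((x \<otimes>\<^bsub>aut_group T G\<^esub> inv\<^bsub>aut_group T G\<^esub> y) u)" if u: "u \<in> verts T" for u
    proof -
      have yi: "inv\<^bsub>aut_group T G\<^esub> y \<in> G" using inv_closed[of y] yG by simp
      let ?z = "(inv\<^bsub>aut_group T G\<^esub> y) u"
      have z: "?z \<in> verts T" "y ?z = u" using act_inv[of y u] yG yi u by simp_all
      have "(x \<otimes>\<^bsub>aut_group T G\<^esub> inv\<^bsub>aut_group T G\<^esub> y) u = x ?z"
        using act_mult[of x _ u] x yi u by simp
      then show ?thesis using key[OF z(1)] z(2) by simp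
    qed
    then show ?thesis using y(1) gG by blast
  qed
  then show ?thesis using F by blast
qed

end

lemma group_index_leD:
  "group_index H K \<le> enat n \<Longrightarrow> finite (rcosets\<^bsub>H\<^esub> K) \<and> card (rcosets\<^bsub>H\<^esub> K) \<le> n"
  unfolding group_index_def by (cases "finite (rcosets\<^bsub>H\<^esub> K)") simp_all

section \<open>The bound for self-reproducing branch groups\<close>

theorem proposition3p3:
  fixes T :: "'a rgraph" and G :: "('a \<Rightarrow> 'a) set" and v :: 'a
  assumes "rooted_tree T"
    and "closed_subgroup T G"
    and "just_infinite (aut_group T G) (sub_topology T G)"
    and "branch_group T G"
    and "v \<in> verts T" and "v \<noteq> rt T"
    and "self_reproducing_at T G v"
  shows "\<exists>c::nat. \<forall>n\<ge>1. ob (aut_group T G) (sub_topology T G) n \<le> enat (c ^ n)"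
proof -
  let ?G = "aut_group T G" and ?X = "sub_topology T G"
  interpret tree_action T G
    using assms(1,2,4) by unfold_locales (simp_all add: branch_group_def)
  obtain f where f: "f \<in> rooted_iso T (subtree T v)"
    and iso: "(\<lambda>g. restrict (f \<circ> g \<circ> inv_into (verts T) f) (descendants T v)) \<in> iso ?G (U_group T G v)"
    using assms(7) by (auto simp: self_reproducing_at_def)
  have fbij: "bij_betw f (verts T) (descendants T v)" and frt: "f (rt T) = v"
    using f by (simp_all add: rooted_iso_def subtree_def)
  have conj_image: "(\<lambda>g. restrict (f \<circ> g \<circ> inv_into (verts T) f) (descendants T v)) ` G = U_set T G v"
    using iso by (simp add: iso_def bij_betw_def U_group_def aut_group_def)
  have fD: "f u \<in> descendants T v" "inv_into (verts T) f (f u) = u" if "u \<in> verts T" for u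
    using that fbij by (auto simp: bij_betw_def)
  interpret self_reproducing_action ?G "verts T" "vnorm T" "descendants T" "rt T" f
  proof (unfold_locales, unfold frt carrier_aut_group)
    show "bij_betw f (verts T) (descendants T v)" by (rule fbij)
    show "v \<in> verts T" "v \<noteq> rt T" by (rule assms)+
    show "vnorm T (f u) = vnorm T v + vnorm T u" if "u \<in> verts T" for u
      by (rule iso_subtree_vnorm[OF f assms(5) that])
    show "f w \<in> descendants T (f u)" if "u \<in> verts T" "w \<in> descendants T u" for u w
      by (rule iso_subtree_descendants[OF f assms(5) that(2)])
    show "\<exists>g\<in>G. \<forall>u\<in>verts T. g (f u) = f (x u)" if x: "x \<in> G" for x
    proof -
      have "restrict (f \<circ> x \<circ> inv_into (verts T) f) (descendants T v) \<in> U_set T G v"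
        using conj_image x by blast
      then obtain g where g: "g \<in> G"
        "restrict (f \<circ> x \<circ> inv_into (verts T) f) (descendants T v) = restrict g (descendants T v)"
        by (auto simp: U_set_def)
      have "g (f u) = f (x u)" if "u \<in> verts T" for u
        using restrict_eqD[OF g(2) fD(1)[OF that]] fD(2)[OF that] by simp
      then show ?thesis using g(1) by blast
    qed
    show "\<exists>x\<in>G. \<forall>u\<in>verts T. g (f u) = f (x u)" if g: "g \<in> G" "g v = v" for g
    proof -
      have "restrict g (descendants T v) \<in> U_set T G v" using g by (auto simp: U_set_def)
      then obtain x where x: "x \<in> G"
        "restrict g (descendants T v) = restrict (f \<circ> x \<circ> inv_into (verts T) f) (descendants T v)"
        unfolding conj_image[symmetric] by blast
      have "g (f u) = f (x u)" if "u \<in> verts T" for u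
        using restrict_eqD[OF x(2) fD(1)[OF that]] fD(2)[OF that] by simp
      then show ?thesis using x(1) by blast
    qed
    show "h \<in> G" if "h \<in> extensional (verts T)"
      "\<And>k. \<exists>g\<in>G. \<forall>u\<in>verts T. vnorm T u \<le> k \<longrightarrow> h u = g u" for h
      by (rule approximable_mem[OF that(1)]) (use that(2) in \<open>simp add: agree_def\<close>)
    show "\<exists>F. finite F \<and> F \<subseteq> G \<and> (\<forall>x\<in>G. \<exists>y\<in>F. \<exists>g\<in>G.
       (\<forall>u\<in>verts T. g (f u) = f ((x \<otimes>\<^bsub>?G\<^esub> inv\<^bsub>?G\<^esub> y) u)) \<and>
       (\<forall>w\<in>verts T - descendants T v. g w = w))"
    proof (rule branch_cover[OF f assms(5)])
      show "restrict (f \<circ> x \<circ> inv_into (verts T) f) (descendants T v) \<in> U_set T G v" if "x \<in> G" for x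
        using conj_image that by blast
      show "group_index (U_layer T G (vnorm T v)) (L_layer T G (vnorm T v)) < \<infinity>"
        using assms(4) by (simp add: branch_group_def)
    qed
    show "infinite G" using assms(3) by (simp add: just_infinite_def)
    show "finite (rcosets\<^bsub>?G\<^esub> N)" if "N \<lhd> ?G" "lev_closed N" "N \<noteq> {\<one>\<^bsub>?G\<^esub>}" for N
    proof -
      have "group_index ?G N < \<infinity>"
        using assms(3) that lev_closed_imp_closedin unfolding just_infinite_def by blast
      then show ?thesis by (auto simp: group_index_def split: if_splits)
    qed
  qed
  from obliquity_bound obtain c where c: "\<forall>n\<ge>1. \<exists>s s'. s' \<le> s \<and> card (germs s) \<le> c ^ n \<and>
     (\<forall>K k. K \<lhd> ?G \<longrightarrow> St k \<subseteq> K \<longrightarrow> finite (rcosets\<^bsub>?G\<^esub> K) \<longrightarrow> card (rcosets\<^bsub>?G\<^esub> K) \<le> n \<longrightarrow> St s' \<subseteq> K) \<and>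
     (\<forall>K k. K \<lhd> ?G \<longrightarrow> St k \<subseteq> K \<longrightarrow> \<not> K \<subseteq> St s' \<longrightarrow> St s \<subseteq> K)" ..
  show ?thesis
  proof (intro exI[of _ c] allI impI)
    fix n :: nat assume n: "1 \<le> n"
    obtain s s' where S: "s' \<le> s \<and> card (germs s) \<le> c ^ n \<and>
     (\<forall>K k. K \<lhd> ?G \<longrightarrow> St k \<subseteq> K \<longrightarrow> finite (rcosets\<^bsub>?G\<^esub> K) \<longrightarrow> card (rcosets\<^bsub>?G\<^esub> K) \<le> n \<longrightarrow> St s' \<subseteq> K) \<and>
     (\<forall>K k. K \<lhd> ?G \<longrightarrow> St k \<subseteq> K \<longrightarrow> \<not> K \<subseteq> St s' \<longrightarrow> St s \<subseteq> K)"
      using c[rule_format, OF n] by (elim exE) (rule that)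
    note s = S[THEN conjunct1] S[THEN conjunct2, THEN conjunct1]
    note small = S[THEN conjunct2, THEN conjunct2, THEN conjunct1, rule_format]
    note large = S[THEN conjunct2, THEN conjunct2, THEN conjunct2, rule_format]
    define I where "I = open_normal_inter ?G ?X n"
    have St: "\<exists>k. St k \<subseteq> K" if "K \<lhd> ?G" "openin ?X K" for K
      using openin_imp_contains_St[OF normal_imp_subgroup[OF that(1)] that(2)] .
    have small': "St s' \<subseteq> K" if K: "K \<lhd> ?G" "openin ?X K" "group_index ?G K \<le> enat n" for K
    proof -
      obtain k where k: "St k \<subseteq> K" using St[OF K(1,2)] by blast
      have "finite (rcosets\<^bsub>?G\<^esub> K)" "card (rcosets\<^bsub>?G\<^esub> K) \<le> n"
        using group_index_leD[OF K(3)] by blast+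
      then show ?thesis by (rule small[OF K(1) k])
    qed
    then have I: "St s' \<subseteq> I" unfolding I_def open_normal_inter_def by (intro Inter_greatest) simp
    \<comment> \<open>The group \<open>G\<close> itself belongs to \<open>\<K>\<close>, so \<open>Ob\<close> is an intersection of a non-empty family of
      subgroups.\<close>
    define \<K> where "\<K> = {K. K \<lhd> ?G \<and> openin ?X K \<and> (group_index ?G K \<le> enat n \<or> \<not> K \<subseteq> I)}"
    have Ob: "Ob ?G ?X I = \<Inter>\<K>"
      by (auto simp: Ob_def \<K>_def I_def open_normal_inter_def)
    have "G \<in> \<K>"
    proof -
      have self: "subgroup G ?G" using subgroup_self by simp
      have "G #>\<^bsub>?G\<^esub> a = G" if "a \<in> G" for a
        using coset_join2[OF _ self] that by simp
      then have "rcosets\<^bsub>?G\<^esub> G \<subseteq> {G}" by (auto simp: RCOSETS_def)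
      then have "finite (rcosets\<^bsub>?G\<^esub> G)" "card (rcosets\<^bsub>?G\<^esub> G) \<le> 1"
        using finite_subset card_mono[of "{G}"] by fastforce+
      then have "group_index ?G G \<le> enat n" using n by (simp add: group_index_def)
      moreover have "G \<lhd> ?G" using St_normal[of 0] by (simp add: St_0)
      moreover have "openin ?X G" using openin_topspace[of ?X] by (simp add: topspace_sub_topology)
      ultimately show ?thesis by (simp add: \<K>_def)
    qed
    then have sub: "subgroup (\<Inter>\<K>) ?G"
      by (intro subgroups_Inter) (auto simp: \<K>_def normal_imp_subgroup)
    have "St s \<subseteq> K" if "K \<in> \<K>" for K
    proof (cases "K \<subseteq> I")
      case True
      then have "St s' \<subseteq> K" using that small'[of K] by (simp add: \<K>_def)
      then show ?thesis using St_antimono[OF s(1)] by blast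
    next
      case False
      then have "\<not> K \<subseteq> St s'" using I by blast
      moreover have K: "K \<lhd> ?G" "openin ?X K" using that by (simp_all add: \<K>_def)
      obtain k where "St k \<subseteq> K" using St[OF K] by blast
      ultimately show ?thesis by (intro large[OF K(1)])
    qed
    then have "St s \<subseteq> \<Inter>\<K>" by blast
    from index_le_germs[OF sub this] s(2)
    show "ob ?G ?X n \<le> enat (c ^ n)"
      by (simp add: ob_def I_def[symmetric] Ob group_index_def)
  qed
qed

end
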